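(* Let $(X,d)$ be a metric space and let $\Phi$ be a continuous-time topological flow or semiflow on $X$. Let $\Phi^{\mathrm{d},1}$ be the discrete-time topological flow (respectively semiflow) on $X$ determined by $\Phi^{\mathrm{d},1}(1,x)=\Phi(1,x)$, $x\in X$. If $\ell\colon X\to[0,1]$ is a continuous function that is a complete Lyapunov function for $\Phi^{\mathrm{d},1}$, then the function $L\colon X\to\mathbb{R}$ given by $$L(x)=\int_0^1\ell(\Phi(s,x))\,ds$$ is a complete Lyapunov function for $\Phi$. In particular, if $X$ is separable, then there exists a complete Lyapunov function for $\Phi$.
   Context: $\mathbb{T}$ denotes either $\mathbb{R}$ (continuous time) or $\mathbb{Z}$ (discrete time), and $\mathbb{T}_{\ge 0}$, $\mathbb{T}_{>0}$, $\mathbb{T}_{\ge T}$ denote the sets of $t\in\mathbb{T}$ with $t\ge 0$, $t>0$, $t\ge T$. A topological semiflow on a topological space $X$ is a continuous map $\Phi\colon\mathbb{T}_{\ge 0}\times X\to X$ with $\Phi(0,x)=x$ and $\Phi(t_1,\Phi(t_2,x))=\Phi(t_1+t_2,x)$ for all $t_1,t_2\in\mathbb{T}_{\ge0}$, $x\in X$. A topological flow is a continuous map $\Phi\colon\mathbb{T}\times X\to X$ with the same properties for all $t_1,t_2\in\mathbb{T}$. It is continuous-time if $\mathbb{T}=\mathbb{R}$ and discrete-time if $\mathbb{T}=\mathbb{Z}$. Chains. An error function is a continuous function $\varepsilon\colon X\to\mathbb{R}_{>0}$. For $x,y\in X$, an error function $\varepsilon$, and $T\in\mathbb{T}_{>0}$,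 an $(\varepsilon,T)$-chain for $\Phi$ from $x$ to $y$ consists of an integer $k\ge1$, points $x_0,\dots,x_k\in X$ and times $t_0,\dots,t_{k-1}\in\mathbb{T}_{\ge T}$ with $x_0=x$, $x_k=y$ and $d(\Phi(t_j,x_j),x_{j+1})<\varepsilon(\Phi(t_j,x_j))$ for $j\in\{0,\dots,k-1\}$. A point $x$ is chain recurrent for $\Phi$ if, for each error function $\varepsilon$ and each $T\in\mathbb{T}_{>0}$, there is an $(\varepsilon,T)$-chain from $x$ to itself; $\mathrm{ChRec}(\Phi)$ is the set of chain recurrent points. Points $x,y$ are chain equivalent for $\Phi$ if, for each error function $\varepsilon$ and each $T\in\mathbb{T}_{>0}$, there are $(\varepsilon,T)$-chains from $x$ to $y$ and from $y$ to $x$. A complete Lyapunov function for a topological flow or semiflow $\Phi$ (with time domain $\mathbb{T}$) is a continuous function $L\colon X\to[0,1]$ such that: (i) $L(\Phi(t_2,x))\le L(\Phi(t_1,x))$ for $x\in X$ and $t_1,t_2\in\mathbb{T}_{\ge0}$ with $t_1<t_2$; (ii) $L(\Phi(t,x))<L(x)$ for $x\in X\setminus\mathrm{ChRec}(\Phi)$ and $t\in\mathbb{T}_{>0}$; (iii) $L(\Phi(t,x))=L(x)$ for $x\in\mathrm{ChRec}(\Phi)$ and $t\in\mathbb{T}_{\ge0}$; (iv) points $x,y\in\mathrm{ChRec}(\Phi)$ are chain equivalent if and only if $L(x)=L(y)$. *)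

theory Defs
  imports "HOL-Analysis.Analysis"
begin

(* The time domain is a type: real for continuous time, int (with its discrete topology)
   for discrete time.  X is the whole type 'a.  A semiflow is a function on {0..} x X;
   its values at negative times are unconstrained and never used. *)

definition topological_semiflow ::
  "('t::{linordered_idom,topological_space} \<Rightarrow> 'a::topological_space \<Rightarrow> 'a) \<Rightarrow> bool" where
  "topological_semiflow \<Phi> \<longleftrightarrow>
     continuous_on ({0..} \<times> UNIV) (\<lambda>(t, x). \<Phi> t x) \<and>
     (\<forall>x. \<Phi> 0 x = x) \<and>
     (\<forall>t1\<ge>0. \<forall>t2\<ge>0. \<forall>x. \<Phi> t1 (\<Phi> t2 x) = \<Phi> (t1 + t2) x)"

definition topological_flow ::
  "('t::{linordered_idom,topological_space} \<Rightarrow> 'a::topological_space \<Rightarrow> 'a) \<Rightarrow> bool" where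
  "topological_flow \<Phi> \<longleftrightarrow>
     continuous_on UNIV (\<lambda>(t, x). \<Phi> t x) \<and>
     (\<forall>x. \<Phi> 0 x = x) \<and>
     (\<forall>t1 t2 x. \<Phi> t1 (\<Phi> t2 x) = \<Phi> (t1 + t2) x)"

definition error_function :: "('a::topological_space \<Rightarrow> real) \<Rightarrow> bool" where
  "error_function \<epsilon> \<longleftrightarrow> continuous_on UNIV \<epsilon> \<and> (\<forall>x. \<epsilon> x > 0)"

definition chain ::
  "('t::{linordered_idom,topological_space} \<Rightarrow> 'a::metric_space \<Rightarrow> 'a) \<Rightarrow>
   ('a \<Rightarrow> real) \<Rightarrow> 't \<Rightarrow> 'a \<Rightarrow> 'a \<Rightarrow> bool" where
  "chain \<Phi> \<epsilon> T x y \<longleftrightarrow>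
     (\<exists>k\<ge>1. \<exists>(p :: nat \<Rightarrow> 'a) (t :: nat \<Rightarrow> 't).
        p 0 = x \<and> p k = y \<and>
        (\<forall>j<k. t j \<ge> T \<and> dist (\<Phi> (t j) (p j)) (p (Suc j)) < \<epsilon> (\<Phi> (t j) (p j))))"

definition chain_recurrent ::
  "('t::{linordered_idom,topological_space} \<Rightarrow> 'a::metric_space \<Rightarrow> 'a) \<Rightarrow> 'a \<Rightarrow> bool" where
  "chain_recurrent \<Phi> x \<longleftrightarrow> (\<forall>\<epsilon> T. error_function \<epsilon> \<and> T > 0 \<longrightarrow> chain \<Phi> \<epsilon> T x x)"

definition ChRec ::
  "('t::{linordered_idom,topological_space} \<Rightarrow> 'a::metric_space \<Rightarrow> 'a) \<Rightarrow> 'a set" where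
  "ChRec \<Phi> = {x. chain_recurrent \<Phi> x}"

definition chain_equivalent ::
  "('t::{linordered_idom,topological_space} \<Rightarrow> 'a::metric_space \<Rightarrow> 'a) \<Rightarrow> 'a \<Rightarrow> 'a \<Rightarrow> bool" where
  "chain_equivalent \<Phi> x y \<longleftrightarrow>
     (\<forall>\<epsilon> T. error_function \<epsilon> \<and> T > 0 \<longrightarrow> chain \<Phi> \<epsilon> T x y \<and> chain \<Phi> \<epsilon> T y x)"

definition complete_Lyapunov_function ::
  "('t::{linordered_idom,topological_space} \<Rightarrow> 'a::metric_space \<Rightarrow> 'a) \<Rightarrow> ('a \<Rightarrow> real) \<Rightarrow> bool" where
  "complete_Lyapunov_function \<Phi> L \<longleftrightarrow>
     continuous_on UNIV L \<and> (\<forall>x. L x \<in> {0..1}) \<and>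
     (\<forall>x. \<forall>t1\<ge>0. \<forall>t2\<ge>0. t1 < t2 \<longrightarrow> L (\<Phi> t2 x) \<le> L (\<Phi> t1 x)) \<and>
     (\<forall>x. x \<notin> ChRec \<Phi> \<longrightarrow> (\<forall>t>0. L (\<Phi> t x) < L x)) \<and>
     (\<forall>x\<in>ChRec \<Phi>. \<forall>t\<ge>0. L (\<Phi> t x) = L x) \<and>
     (\<forall>x\<in>ChRec \<Phi>. \<forall>y\<in>ChRec \<Phi>. chain_equivalent \<Phi> x y \<longleftrightarrow> L x = L y)"

(* A discrete-time flow (semiflow) with time-one map \<Phi> 1 exists and is unique (the latter
   on nonnegative times for semiflows), so quantifying over all such \<Psi> is the same as
   speaking about the one determined by \<Phi> 1. *)

lemma topological_flow_time_one:
  fixes \<Phi> :: "real \<Rightarrow> 'a::metric_space \<Rightarrow> 'a"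
  assumes "topological_flow \<Phi>"
  shows "topological_flow (\<lambda>n::int. \<Phi> (of_int n))"
proof -
  have c: "continuous_on UNIV (\<lambda>(t, x). \<Phi> t x)"
    using assms by (simp add: topological_flow_def)
  have i: "continuous_on UNIV (\<lambda>z :: int \<times> 'a. (real_of_int (fst z), snd z))"
    by (intro continuous_intros)
  have "continuous_on UNIV (\<lambda>(n::int, x). \<Phi> (of_int n) x)"
    using continuous_on_compose2[OF c i] by (simp add: case_prod_unfold)
  then show ?thesis
    using assms by (simp add: topological_flow_def)
qed

lemma topological_semiflow_time_one:
  fixes \<Phi> :: "real \<Rightarrow> 'a::metric_space \<Rightarrow> 'a"
  assumes "topological_semiflow \<Phi>"
  shows "topological_semiflow (\<lambda>n::int. \<Phi> (of_int n))"
proof -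
  have c: "continuous_on ({0..} \<times> UNIV) (\<lambda>(t, x). \<Phi> t x)"
    using assms by (simp add: topological_semiflow_def)
  have i: "continuous_on ({0..} \<times> UNIV) (\<lambda>z :: int \<times> 'a. (real_of_int (fst z), snd z))"
    by (intro continuous_intros)
  have "continuous_on ({0..} \<times> UNIV) (\<lambda>(n::int, x). \<Phi> (of_int n) x)"
    using continuous_on_compose2[OF c i] by (force simp: case_prod_unfold)
  then show ?thesis
    using assms by (simp add: topological_semiflow_def)
qed

lemma topological_semiflow_int_unique:
  fixes \<Psi> \<Psi>' :: "int \<Rightarrow> 'a::metric_space \<Rightarrow> 'a"
  assumes "topological_semiflow \<Psi>" "topological_semiflow \<Psi>'"
    and "\<And>x. \<Psi> 1 x = \<Psi>' 1 x" and "n \<ge> 0"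
  shows "\<Psi> n x = \<Psi>' n x"
  using \<open>n \<ge> 0\<close>
proof (induction n rule: int_ge_induct)
  case base
  then show ?case using assms by (simp add: topological_semiflow_def)
next
  case (step i)
  have "\<Psi> (1 + i) x = \<Psi> 1 (\<Psi> i x)" "\<Psi>' (1 + i) x = \<Psi>' 1 (\<Psi>' i x)"
    using assms(1,2) step.hyps by (simp_all add: topological_semiflow_def)
  with step.IH assms(3) show ?case by (simp add: add.commute)
qed

lemma topological_flow_imp_semiflow: "topological_flow \<Phi> \<Longrightarrow> topological_semiflow \<Phi>"
  unfolding topological_flow_def topological_semiflow_def
  by (meson continuous_on_subset subset_UNIV)

lemma topological_flow_int_unique:
  fixes \<Psi> \<Psi>' :: "int \<Rightarrow> 'a::metric_space \<Rightarrow> 'a"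
  assumes "topological_flow \<Psi>" "topological_flow \<Psi>'" and "\<And>x. \<Psi> 1 x = \<Psi>' 1 x"
  shows "\<Psi> n x = \<Psi>' n x"
proof (cases "n \<ge> 0")
  case True
  then show ?thesis
    by (rule topological_semiflow_int_unique[OF assms(1,2)[THEN topological_flow_imp_semiflow] assms(3)])
next
  case False
  have inv: "\<Psi> (- n) (\<Psi> n x) = x" "\<Psi>' n (\<Psi>' (- n) y) = y" for y
    using assms(1,2) by (simp_all add: topological_flow_def)
  have "\<Psi> (- n) y = \<Psi>' (- n) y" for y
    using False
    by (intro topological_semiflow_int_unique[OF assms(1,2)[THEN topological_flow_imp_semiflow] assms(3)]) simp
  then have "\<Psi>' (- n) (\<Psi> n x) = x"
    using inv(1) by simp
  then show ?thesis
    using inv(2)[of "\<Psi> n x"] by simp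
qed

end

theory Submission
  imports Defs
begin

text \<open>Write \<open>f\<close> for the time-one map. Both parts rest on the fact that chain recurrence and chain
  equivalence for the flow agree with those for \<open>f\<close>. A chain of the flow sampled at integer times is
  a pseudo-orbit of \<open>f\<close>, except that it misses its end point by a fractional time. For a
  chain recurrent point, repeating a loop makes that fraction small by Dirichlet approximation, so the
  point is chain recurrent for \<open>f\<close>. Its forward orbit is then a connected set of chain recurrent
  points of \<open>f\<close> and hence lies in one chain class of \<open>f\<close>, which absorbs the missing fraction for
  chains between different points. It follows that \<open>L = \<ell>\<close> on the chain recurrent set, while
  \<open>L(x) - L(\<Phi>(t,x))\<close> is the integral of \<open>\<ell>(\<Phi>(s,x)) - \<ell>(\<Phi>(s+1,x))\<close> over \<open>[0,t]\<close>.

  For existence, consider the continuous \<open>g: X \<rightarrow> [0,1]\<close> such that \<open>g(x) < 1\<close> implies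
  \<open>g(f(x)) = 0\<close>. Such a function decreases along orbits and takes only the values 0 and 1 on the chain
  recurrent set, and these functions separate whatever pseudo-orbits fail to connect. In a separable
  space countably many of them suffice, and their sum with weights \<open>2/3^(n+1)\<close> is a complete
  Lyapunov function, because distinct 0-1 sequences give distinct points of the Cantor set.\<close>

subsection \<open>Error functions\<close>

text \<open>The infimal convolution of \<open>g\<close> with the distance is 1-Lipschitz and at most
  \<open>g\<close>. It is positive at \<open>w\<close> because points near \<open>w\<close>
  contribute at least \<open>r\<close> through \<open>g\<close>, and all others at least
  \<open>r\<close> through the distance.\<close>

lemma error_function_below:
  fixes g :: "'a::metric_space \<Rightarrow> real"
  assumes loc: "\<And>w. \<exists>r>0. \<forall>y. dist w y < r \<longrightarrow> r \<le> g y"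
  shows "\<exists>\<delta>. error_function \<delta> \<and> (\<forall>y. \<delta> y \<le> g y)"
proof -
  define \<delta> where "\<delta> w = (INF y. g y + dist w y)" for w
  have g0: "g y > 0" for y
    using loc[of y] by (metis dist_self less_le_trans)
  have bdd: "bdd_below (range (\<lambda>y. g y + dist w y))" for w
    by (intro bdd_belowI[of _ 0]) (auto intro!: add_nonneg_nonneg less_imp_le[OF g0])
  have le: "\<delta> w \<le> g y + dist w y" for w y
    unfolding \<delta>_def by (rule cINF_lower[OF bdd]) simp
  have lip: "\<delta> w \<le> \<delta> v + dist w v" for w v
  proof -
    have "\<delta> w - dist w v \<le> g y + dist v y" for y
      using le[of w y] dist_triangle[of w y v] by simp
    then have "\<delta> w - dist w v \<le> \<delta> v"
      unfolding \<delta>_def[of v] by (intro cINF_greatest) auto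
    then show ?thesis by simp
  qed
  have "\<bar>\<delta> w - \<delta> v\<bar> \<le> dist w v" for w v
    using lip[of w v] lip[of v w] by (simp add: dist_commute abs_le_iff)
  then have "continuous_on UNIV \<delta>"
    unfolding continuous_on_iff dist_real_def
    by (metis (no_types, opaque_lifting) dist_commute le_less_trans)
  moreover have "\<delta> w > 0" for w
  proof -
    obtain r where r: "r > 0" "\<And>y. dist w y < r \<Longrightarrow> r \<le> g y"
      using loc[of w] by blast
    have "r \<le> g y + dist w y" for y
      using r(2)[of y] g0[of y] by (cases "dist w y < r") (auto intro: order_trans)
    then have "r \<le> \<delta> w"
      unfolding \<delta>_def by (intro cINF_greatest) auto
    with r show ?thesis by simp
  qed
  moreover have "\<delta> y \<le> g y" for y
    using le[of y y] by simp
  ultimately show ?thesis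
    by (auto simp: error_function_def)
qed

text \<open>Turns a locally uniform choice of radii into a continuous one:
  \<open>error_function_below\<close> is applied to half the supremum of the admissible
  radii.\<close>

lemma error_function_exists:
  fixes P :: "'a::metric_space \<Rightarrow> real \<Rightarrow> bool"
  assumes mono: "\<And>y r r'. P y r \<Longrightarrow> 0 < r' \<Longrightarrow> r' \<le> r \<Longrightarrow> P y r'"
    and loc: "\<And>w. \<exists>r>0. \<forall>y. dist w y < r \<longrightarrow> P y r"
  shows "\<exists>\<delta>. error_function \<delta> \<and> (\<forall>y. P y (\<delta> y))"
proof -
  \<comment> \<open>The cap 1 makes the supremum finite. Halving it leaves room for an admissible
    radius strictly above \<open>g y\<close>, to which \<open>mono\<close> applies.\<close>
  define S where "S y = {r. 0 < r \<and> r \<le> 1 \<and> P y r}" for y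
  define g where "g y = Sup (S y) / 2" for y
  have bdd: "bdd_above (S y)" for y
    by (rule bdd_aboveI[of _ 1]) (auto simp: S_def)
  have "\<exists>r>0. \<forall>y. dist w y < r \<longrightarrow> r \<le> g y" for w
  proof -
    obtain r where r: "r > 0" "\<And>y. dist w y < r \<Longrightarrow> P y r"
      using loc[of w] by blast
    have "min r 1 / 2 \<le> g y" if "dist w y < min r 1 / 2" for y
    proof -
      have "min r 1 \<in> S y"
        using r that mono[of y r "min r 1"] by (auto simp: S_def)
      then show ?thesis
        using cSup_upper[OF _ bdd] by (simp add: g_def)
    qed
    with r(1) show ?thesis
      by (intro exI[of _ "min r 1 / 2"]) auto
  qed
  then obtain \<delta> where \<delta>: "error_function \<delta>" "\<And>y. \<delta> y \<le> g y"
    using error_function_below by blast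
  have "P y (\<delta> y)" for y
  proof -
    have pos: "\<delta> y > 0"
      using \<delta>(1) by (simp add: error_function_def)
    then have "g y < Sup (S y)"
      using \<delta>(2)[of y] by (simp add: g_def)
    moreover have "S y \<noteq> {}"
      using loc[of y] mono[of y _ "min _ 1"] unfolding S_def
      by (metis (mono_tags, lifting) dist_self empty_iff mem_Collect_eq min.cobounded1 min.cobounded2 min_less_iff_conj zero_less_one)
    ultimately obtain r where "r \<in> S y" "g y < r"
      by (metis less_cSup_iff bdd)
    with \<delta>(2)[of y] pos show ?thesis
      by (auto simp: S_def intro: mono)
  qed
  with \<delta>(1) show ?thesis by blast
qed

lemma error_function_min:
  "error_function \<delta> \<Longrightarrow> error_function \<epsilon> \<Longrightarrow> error_function (\<lambda>x. min (\<delta> x) (\<epsilon> x))"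
  by (auto simp: error_function_def intro: continuous_on_min)

lemma error_function_pos: "error_function \<epsilon> \<Longrightarrow> \<epsilon> x > 0"
  by (simp add: error_function_def)

text \<open>The slack \<open>G\<close> in the desired inequality is positive at
  \<open>(w0, w0)\<close> for every parameter, so it has a positive minimum over the compact
  \<open>K\<close>. Compactness again keeps it at least half that minimum near
  \<open>(w0, w0)\<close>, uniformly in the parameter.\<close>

lemma error_function_modulus:
  fixes H :: "'s::metric_space \<Rightarrow> 'a::metric_space \<Rightarrow> 'b::metric_space"
  assumes K: "compact K" "K \<noteq> {}"
    and H: "continuous_on (K \<times> UNIV) (\<lambda>(s, x). H s x)"
    and \<epsilon>: "error_function \<epsilon>"
  shows "\<exists>\<delta>. error_function \<delta> \<and>
    (\<forall>w y. dist w y < \<delta> w \<longrightarrow> (\<forall>s\<in>K. dist (H s w) (H s y) < \<epsilon> (H s w)))"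
proof -
  have "\<exists>r>0. \<forall>w. dist w0 w < r \<longrightarrow>
     (\<forall>y. dist w y < r \<longrightarrow> (\<forall>s\<in>K. dist (H s w) (H s y) < \<epsilon> (H s w)))" for w0
  proof -
    have \<epsilon>c: "continuous_on UNIV \<epsilon>"
      using \<epsilon> by (simp add: error_function_def)
    have c1: "continuous_on (A \<times> K) (\<lambda>z. H (snd z) (p (fst z)))"
      if "continuous_on A p" for p :: "'c::topological_space \<Rightarrow> 'a" and A
      using continuous_on_compose2[OF H, of "A \<times> K" "\<lambda>z. (snd z, p (fst z))"] that
      by (fastforce intro!: continuous_intros continuous_on_compose2[OF that])
    define G where "G z = \<epsilon> (H (snd z) (fst (fst z))) - dist (H (snd z) (fst (fst z))) (H (snd z) (snd (fst z)))"
      for z :: "('a \<times> 'a) \<times> 's"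
    have Gc: "continuous_on (UNIV \<times> K) G"
      unfolding G_def
      by (intro continuous_intros continuous_on_compose2[OF \<epsilon>c] c1) auto
    have "continuous_on K (\<lambda>s. G ((w0, w0), s))"
      by (rule continuous_on_compose2[OF Gc]) (auto intro!: continuous_intros)
    then obtain s0 where s0: "s0 \<in> K" "\<And>s. s \<in> K \<Longrightarrow> G ((w0, w0), s0) \<le> G ((w0, w0), s)"
      using continuous_attains_inf[OF K] by metis
    define m where "m = G ((w0, w0), s0)"
    have "m > 0"
      using \<epsilon> by (simp add: m_def G_def error_function_def)
    from continuous_on_prod_compactE[OF Gc K(1) UNIV_I, of "m / 2" "(w0, w0)"]
    obtain X0 where X0: "(w0, w0) \<in> X0" "open X0"
      "\<forall>x\<in>X0 \<inter> UNIV. \<forall>t\<in>K. dist (G (x, t)) (G ((w0, w0), t)) \<le> m / 2"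
      using \<open>m > 0\<close> by (metis half_gt_zero)
    obtain r where r: "r > 0" "ball (w0, w0) r \<subseteq> X0"
      using X0 open_contains_ball by metis
    have "dist (H s w) (H s y) < \<epsilon> (H s w)"
      if "dist w0 w < r / 3" "dist w y < r / 3" "s \<in> K" for w y s
    proof -
      have "dist w0 y < 2 * r / 3"
        using dist_triangle[of w0 y w] that by simp
      moreover have "dist (w0, w0) (w, y) \<le> dist w0 w + dist w0 y"
        unfolding dist_Pair_Pair by (rule sqrt_sum_squares_le_sum) auto
      ultimately have "(w, y) \<in> X0"
        using r(2) that by (auto simp: subset_iff)
      then have "dist (G ((w, y), s)) (G ((w0, w0), s)) \<le> m / 2"
        using X0(3) that(3) by blast
      then have "G ((w, y), s) \<ge> m / 2"
        using s0(2)[OF that(3)] unfolding dist_real_def m_def[symmetric] by (smt (verit) field_sum_of_halves)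
      then show ?thesis
        using \<open>m > 0\<close> by (simp add: G_def)
    qed
    with r(1) show ?thesis
      by (intro exI[of _ "r / 3"]) auto
  qed
  then show ?thesis
    by (intro error_function_exists[of "\<lambda>w r. \<forall>y. dist w y < r \<longrightarrow> (\<forall>s\<in>K. dist (H s w) (H s y) < \<epsilon> (H s w))"]) auto
qed

lemma error_function_modulus_map:
  fixes f :: "'a::metric_space \<Rightarrow> 'b::metric_space"
  assumes "continuous_on UNIV f" "error_function \<epsilon>"
  shows "\<exists>\<delta>. error_function \<delta> \<and> (\<forall>w y. dist w y < \<delta> w \<longrightarrow> dist (f w) (f y) < \<epsilon> (f w))"
proof -
  \<comment> \<open>A single map is a family over a one-point parameter set.\<close>
  have "continuous_on ({0::real} \<times> UNIV) (\<lambda>(s, x). f x)"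
    unfolding case_prod_unfold
    by (rule continuous_on_compose2[OF assms(1)]) (auto intro!: continuous_intros)
  from error_function_modulus[OF _ _ this assms(2)] show ?thesis
    by auto
qed

text \<open>The second error is measured at the intermediate point, so \<open>\<epsilon> y\<close>
  is first bounded by \<open>2 * \<epsilon> w\<close>. The two jumps then add up to less than a
  quarter plus a half of \<open>\<epsilon> w\<close>.\<close>

lemma error_function_triangle:
  fixes \<epsilon> :: "'a::metric_space \<Rightarrow> real"
  assumes "error_function \<epsilon>"
  shows "\<exists>\<delta>. error_function \<delta> \<and> (\<forall>w y z. dist w y < \<delta> w \<longrightarrow> dist y z < \<delta> y \<longrightarrow> dist w z < \<epsilon> w)"
proof -
  have "\<exists>r>0. \<forall>w. dist w0 w < r \<longrightarrow> (\<forall>y. dist w y < r \<longrightarrow> \<epsilon> y < 2 * \<epsilon> w)" for w0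
  proof -
    have "0 < \<epsilon> w0 / 3"
      using error_function_pos[OF assms, of w0] by simp
    then obtain r where r: "r > 0" "\<And>y. dist y w0 < r \<Longrightarrow> dist (\<epsilon> y) (\<epsilon> w0) < \<epsilon> w0 / 3"
      using assms unfolding error_function_def continuous_on_iff by (metis UNIV_I)
    have "\<epsilon> y < 2 * \<epsilon> w" if "dist w0 w < r / 2" "dist w y < r / 2" for w y
    proof -
      have "dist y w0 < r"
        using dist_triangle[of y w0 w] that by (simp add: dist_commute)
      moreover have "dist w w0 < r"
        using that r(1) by (simp add: dist_commute)
      ultimately show ?thesis
        using r(2)[of y] r(2)[of w] unfolding dist_real_def by linarith
    qed
    with r(1) show ?thesis
      by (intro exI[of _ "r / 2"]) auto
  qed
  then have "\<exists>\<delta>. error_function \<delta> \<and> (\<forall>w y. dist w y < \<delta> w \<longrightarrow> \<epsilon> y < 2 * \<epsilon> w)"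
    by (intro error_function_exists[of "\<lambda>w r. \<forall>y. dist w y < r \<longrightarrow> \<epsilon> y < 2 * \<epsilon> w"]) auto
  then obtain \<delta> where \<delta>: "error_function \<delta>" "\<And>w y. dist w y < \<delta> w \<Longrightarrow> \<epsilon> y < 2 * \<epsilon> w"
    by blast
  have "error_function (\<lambda>x. \<epsilon> x / 4)"
    using assms by (auto simp: error_function_def intro!: continuous_intros)
  with \<delta>(1) have "error_function (\<lambda>x. min (\<delta> x) (\<epsilon> x / 4))"
    by (rule error_function_min)
  moreover have "dist w z < \<epsilon> w"
    if "dist w y < min (\<delta> w) (\<epsilon> w / 4)" "dist y z < min (\<delta> y) (\<epsilon> y / 4)" for w y z
    using \<delta>(2)[of w y] dist_triangle[of w z y] that error_function_pos[OF assms, of w] by simp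
  ultimately show ?thesis by blast
qed

subsection \<open>Chains and pseudo-orbits of the time-one map\<close>

text \<open>A single link, isolated so that chains become a transitive closure and can be
  concatenated and treated by induction.\<close>

definition flow_step ::
  "('t::{linordered_idom,topological_space} \<Rightarrow> 'a::metric_space \<Rightarrow> 'a) \<Rightarrow>
   ('a \<Rightarrow> real) \<Rightarrow> 't \<Rightarrow> 'a \<Rightarrow> 'a \<Rightarrow> bool" where
  "flow_step \<Phi> \<epsilon> T x y \<longleftrightarrow> (\<exists>t\<ge>T. dist (\<Phi> t x) y < \<epsilon> (\<Phi> t x))"

lemma chain_iff_tranclp: "chain \<Phi> \<epsilon> T x y \<longleftrightarrow> (flow_step \<Phi> \<epsilon> T)\<^sup>+\<^sup>+ x y"
proof
  assume "chain \<Phi> \<epsilon> T x y"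
  then obtain k p t where k: "k \<ge> 1" "p 0 = x" "p k = y"
    "\<forall>j<k. t j \<ge> T \<and> dist (\<Phi> (t j) (p j)) (p (Suc j)) < \<epsilon> (\<Phi> (t j) (p j))"
    unfolding chain_def by blast
  then have "(flow_step \<Phi> \<epsilon> T ^^ k) x y"
    unfolding relpowp_fun_conv flow_step_def by blast
  with k(1) show "(flow_step \<Phi> \<epsilon> T)\<^sup>+\<^sup>+ x y"
    unfolding tranclp_power by (metis less_le_trans zero_less_one)
next
  assume "(flow_step \<Phi> \<epsilon> T)\<^sup>+\<^sup>+ x y"
  then obtain k p where k: "k > 0" "p 0 = x" "p k = y" "\<forall>j<k. flow_step \<Phi> \<epsilon> T (p j) (p (Suc j))"
    unfolding tranclp_power relpowp_fun_conv by blast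
  then obtain t where "\<forall>j<k. t j \<ge> T \<and> dist (\<Phi> (t j) (p j)) (p (Suc j)) < \<epsilon> (\<Phi> (t j) (p j))"
    unfolding flow_step_def by metis
  with k show "chain \<Phi> \<epsilon> T x y"
    unfolding chain_def by (metis One_nat_def Suc_leI)
qed

lemma chain_trans: "chain \<Phi> \<epsilon> T x y \<Longrightarrow> chain \<Phi> \<epsilon> T y z \<Longrightarrow> chain \<Phi> \<epsilon> T x z"
  unfolding chain_iff_tranclp by (rule tranclp_trans)

lemma chain_equivalent_imp_ChRec: "chain_equivalent \<Phi> x y \<Longrightarrow> x \<in> ChRec \<Phi> \<and> y \<in> ChRec \<Phi>"
  unfolding chain_equivalent_def ChRec_def chain_recurrent_def by (blast intro: chain_trans)

definition pseudo_step :: "('a::metric_space \<Rightarrow> 'a) \<Rightarrow> ('a \<Rightarrow> real) \<Rightarrow> 'a \<Rightarrow> 'a \<Rightarrow> bool" where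
  "pseudo_step f \<epsilon> x y \<longleftrightarrow> dist (f x) y < \<epsilon> (f x)"

text \<open>Every step lasts exactly one time unit and no lower bound \<open>T\<close> occurs. From
  a recurrent starting point the long times are recovered in
  \<open>reaches_imp_int_chain\<close>.\<close>

definition reaches :: "('a::metric_space \<Rightarrow> 'a) \<Rightarrow> 'a \<Rightarrow> 'a \<Rightarrow> bool" where
  "reaches f x y \<longleftrightarrow> (\<forall>\<epsilon>. error_function \<epsilon> \<longrightarrow> (pseudo_step f \<epsilon>)\<^sup>+\<^sup>+ x y)"

lemma reaches_trans: "reaches f x y \<Longrightarrow> reaches f y z \<Longrightarrow> reaches f x z"
  unfolding reaches_def by (blast intro: tranclp_trans)

lemma pseudo_step_exact: "error_function \<epsilon> \<Longrightarrow> pseudo_step f \<epsilon> x (f x)"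
  by (simp add: pseudo_step_def error_function_def)

lemma pseudo_step_funpow: "error_function \<epsilon> \<Longrightarrow> (pseudo_step f \<epsilon>)\<^sup>*\<^sup>* x ((f ^^ n) x)"
  by (induction n) (auto intro: rtranclp.rtrancl_into_rtrancl pseudo_step_exact)

lemma pseudo_step_mono:
  "pseudo_step f \<delta> x y \<Longrightarrow> (\<And>z. \<delta> z \<le> \<epsilon> z) \<Longrightarrow> pseudo_step f \<epsilon> x y"
  unfolding pseudo_step_def by (meson less_le_trans)

text \<open>Only the last jump changes: it is merged with the displacement of the end point by the
  triangle estimate. This lets a pseudo-orbit that ends close to its target hit it exactly.\<close>

lemma pseudo_step_move_end:
  assumes "error_function \<epsilon>"
  shows "\<exists>\<delta>. error_function \<delta> \<and>
    (\<forall>x y y'. (pseudo_step f \<delta>)\<^sup>+\<^sup>+ x y \<longrightarrow> dist y y' < \<delta> y \<longrightarrow> (pseudo_step f \<epsilon>)\<^sup>+\<^sup>+ x y')"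
proof -
  obtain \<delta>' where \<delta>': "error_function \<delta>'"
    "\<And>w y z. dist w y < \<delta>' w \<Longrightarrow> dist y z < \<delta>' y \<Longrightarrow> dist w z < \<epsilon> w"
    using error_function_triangle[OF assms] by blast
  define \<delta> where "\<delta> x = min (\<delta>' x) (\<epsilon> x)" for x
  have "(pseudo_step f \<epsilon>)\<^sup>+\<^sup>+ x y'" if xy: "(pseudo_step f \<delta>)\<^sup>+\<^sup>+ x y" "dist y y' < \<delta> y" for x y y'
  proof -
    obtain z where z: "(pseudo_step f \<delta>)\<^sup>*\<^sup>* x z" "pseudo_step f \<delta> z y"
      using xy(1) by (cases rule: tranclp.cases) (auto intro: tranclp_into_rtranclp)
    have "(pseudo_step f \<epsilon>)\<^sup>*\<^sup>* x z"
      using z(1) by (rule rtranclp_mono[THEN predicate2D, rotated])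
        (auto elim!: pseudo_step_mono simp: \<delta>_def)
    moreover have "pseudo_step f \<epsilon> z y'"
      using z(2) xy(2) \<delta>'(2)[of "f z" y y'] by (simp add: pseudo_step_def \<delta>_def)
    ultimately show ?thesis
      by (rule rtranclp_into_tranclp1)
  qed
  moreover have "error_function \<delta>"
    unfolding \<delta>_def using \<delta>'(1) assms by (rule error_function_min)
  ultimately show ?thesis by blast
qed

text \<open>A map commuting with \<open>f\<close> sends pseudo-orbits to pseudo-orbits, the
  tolerance being pulled back by the modulus of continuity of \<open>h\<close>.\<close>

lemma reaches_image:
  assumes h: "continuous_on UNIV h" and commute: "\<And>u. h (f u) = f (h u)" and xy: "reaches f x y"
  shows "reaches f (h x) (h y)"
  unfolding reaches_def
proof (intro allI impI)
  fix \<epsilon> :: "'a \<Rightarrow> real" assume "error_function \<epsilon>"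
  then obtain \<delta> where \<delta>: "error_function \<delta>" "\<And>w y. dist w y < \<delta> w \<Longrightarrow> dist (h w) (h y) < \<epsilon> (h w)"
    using error_function_modulus_map[OF h] by blast
  have step: "pseudo_step f \<epsilon> (h u) (h v)" if "pseudo_step f \<delta> u v" for u v
    using \<delta>(2)[of "f u" v] that by (simp add: pseudo_step_def commute)
  have "(pseudo_step f \<delta>)\<^sup>+\<^sup>+ x y"
    using xy \<delta>(1) by (simp add: reaches_def)
  then show "(pseudo_step f \<epsilon>)\<^sup>+\<^sup>+ (h x) (h y)"
    by induction (auto intro: step tranclp.trancl_into_trancl)
qed

text \<open>Induction on the length: the error accumulated so far is pushed through \<open>f\<close>
  and the new jump is added by the triangle estimate. One \<open>\<delta>\<close> serves all lengths
  up to \<open>N\<close>.\<close>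

lemma pseudo_orbit_close:
  assumes f: "continuous_on UNIV f" and \<epsilon>: "error_function \<epsilon>"
  shows "\<exists>\<delta>. error_function \<delta> \<and>
    (\<forall>n\<le>N. \<forall>x y. (pseudo_step f \<delta> ^^ n) x y \<longrightarrow> dist ((f ^^ n) x) y < \<epsilon> ((f ^^ n) x))"
  using \<epsilon>
proof (induction N arbitrary: \<epsilon>)
  case 0
  then show ?case by (auto simp: error_function_def)
next
  case (Suc N)
  obtain \<epsilon>' where \<epsilon>': "error_function \<epsilon>'"
    "\<And>w y z. dist w y < \<epsilon>' w \<Longrightarrow> dist y z < \<epsilon>' y \<Longrightarrow> dist w z < \<epsilon> w"
    using error_function_triangle[OF Suc.prems] by blast
  obtain \<delta>1 where \<delta>1: "error_function \<delta>1" "\<And>w y. dist w y < \<delta>1 w \<Longrightarrow> dist (f w) (f y) < \<epsilon>' (f w)"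
    using error_function_modulus_map[OF f \<epsilon>'(1)] by blast
  obtain \<delta>2 where \<delta>2: "error_function \<delta>2"
    "\<And>n x y. n \<le> N \<Longrightarrow> (pseudo_step f \<delta>2 ^^ n) x y \<Longrightarrow> dist ((f ^^ n) x) y < \<delta>1 ((f ^^ n) x)"
    using Suc.IH[OF \<delta>1(1)] by blast
  define \<delta> where "\<delta> x = min (\<delta>2 x) (\<epsilon>' x)" for x
  have "error_function \<delta>"
    unfolding \<delta>_def using \<delta>2(1) \<epsilon>'(1) by (rule error_function_min)
  moreover have "dist ((f ^^ n) x) y < \<epsilon> ((f ^^ n) x)"
    if n: "n \<le> Suc N" and xy: "(pseudo_step f \<delta> ^^ n) x y" for n x y
  proof (cases n)
    case 0
    with xy show ?thesis
      using Suc.prems by (simp add: error_function_def)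
  next
    case (Suc m)
    then obtain z where z: "(pseudo_step f \<delta> ^^ m) x z" "pseudo_step f \<delta> z y"
      using xy by auto
    have "(pseudo_step f \<delta>2 ^^ m) x z"
      using z(1) by (rule relpowp_mono[rotated]) (auto elim!: pseudo_step_mono simp: \<delta>_def)
    then have "dist (f ((f ^^ m) x)) (f z) < \<epsilon>' (f ((f ^^ m) x))"
      using n Suc by (intro \<delta>1(2) \<delta>2(2)) auto
    then show ?thesis
      using z(2) Suc \<epsilon>'(2) by (simp add: pseudo_step_def \<delta>_def)
  qed
  ultimately show ?case by blast
qed

section \<open>Discrete-time chains as pseudo-orbits of the time-one map\<close>

lemma topological_semiflow_int_funpow:
  fixes \<Psi> :: "int \<Rightarrow> 'a::metric_space \<Rightarrow> 'a"
  assumes "topological_semiflow \<Psi>"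
  shows "\<Psi> (int n) x = (\<Psi> 1 ^^ n) x"
proof (induction n)
  case 0
  then show ?case using assms by (simp add: topological_semiflow_def)
next
  case (Suc n)
  have "\<Psi> 1 (\<Psi> (int n) x) = \<Psi> (1 + int n) x"
    using assms by (simp add: topological_semiflow_def)
  with Suc show ?case by simp
qed

lemma topological_semiflow_continuous:
  assumes "topological_semiflow \<Phi>" "t \<ge> 0"
  shows "continuous_on UNIV (\<Phi> t)"
proof -
  have "continuous_on ({0..} \<times> UNIV) (\<lambda>(t, x). \<Phi> t x)"
    using assms by (simp add: topological_semiflow_def)
  from continuous_on_compose2[OF this, of UNIV "Pair t"] show ?thesis
    using assms(2) by (force intro: continuous_intros)
qed

lemma int_chain_imp_pseudo_steps:
  fixes \<Psi> :: "int \<Rightarrow> 'a::metric_space \<Rightarrow> 'a"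
  assumes \<Psi>: "topological_semiflow \<Psi>" and \<epsilon>: "error_function \<epsilon>" and "T > 0"
    and "chain \<Psi> \<epsilon> T x y"
  shows "(pseudo_step (\<Psi> 1) \<epsilon>)\<^sup>+\<^sup>+ x y"
proof -
  have step: "(pseudo_step (\<Psi> 1) \<epsilon>)\<^sup>+\<^sup>+ u v" if "flow_step \<Psi> \<epsilon> T u v" for u v
  proof -
    obtain t where t: "t \<ge> T" "dist (\<Psi> t u) v < \<epsilon> (\<Psi> t u)"
      using \<open>flow_step \<Psi> \<epsilon> T u v\<close> by (auto simp: flow_step_def)
    \<comment> \<open>A link of time \<open>t\<close> is \<open>t - 1\<close> exact steps followed
      by one step that makes the jump.\<close>
    define n where "n = nat (t - 1)"
    have "t = int (Suc n)"
      using t(1) \<open>T > 0\<close> by (simp add: n_def)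
    then have "pseudo_step (\<Psi> 1) \<epsilon> ((\<Psi> 1 ^^ n) u) v"
      using t(2) by (simp only: topological_semiflow_int_funpow[OF \<Psi>] pseudo_step_def) simp
    with pseudo_step_funpow[OF \<epsilon>] show ?thesis
      by (rule rtranclp_into_tranclp1)
  qed
  from assms(4) have "(flow_step \<Psi> \<epsilon> T)\<^sup>+\<^sup>+ x y"
    by (simp add: chain_iff_tranclp)
  then show ?thesis
    by induction (blast intro: step tranclp_trans)+
qed

text \<open>The loop at \<open>x\<close> makes the pseudo-orbit long enough to be cut into blocks of
  length between \<open>N\<close> and \<open>2 * N\<close>. Each block follows a true orbit within
  \<open>\<epsilon>\<close>, so it can be replaced by one link of time at least
  \<open>T\<close>.\<close>

lemma reaches_imp_int_chain:
  fixes \<Psi> :: "int \<Rightarrow> 'a::metric_space \<Rightarrow> 'a"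
  assumes \<Psi>: "topological_semiflow \<Psi>" and \<epsilon>: "error_function \<epsilon>" and "T > 0"
    and xx: "reaches (\<Psi> 1) x x" and xy: "reaches (\<Psi> 1) x y"
  shows "chain \<Psi> \<epsilon> T x y"
proof -
  define N where "N = nat T"
  have N: "N > 0" "T = int N"
    using \<open>T > 0\<close> by (auto simp: N_def)
  obtain \<delta> where \<delta>: "error_function \<delta>"
    "\<And>n x y. n \<le> 2 * N \<Longrightarrow> (pseudo_step (\<Psi> 1) \<delta> ^^ n) x y \<Longrightarrow>
      dist ((\<Psi> 1 ^^ n) x) y < \<epsilon> ((\<Psi> 1 ^^ n) x)"
    using pseudo_orbit_close[OF topological_semiflow_continuous[OF \<Psi>] \<epsilon>, of 1 "2 * N"] by auto
  have step: "flow_step \<Psi> \<epsilon> T x y" if "(pseudo_step (\<Psi> 1) \<delta> ^^ n) x y" "N \<le> n" "n \<le> 2 * N" for n x y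
    unfolding flow_step_def using \<delta>(2)[OF that(3,1)] that N
    by (auto intro!: exI[of _ "int n"] simp: topological_semiflow_int_funpow[OF \<Psi>])
  have chain: "chain \<Psi> \<epsilon> T x y" if "(pseudo_step (\<Psi> 1) \<delta> ^^ n) x y" "N \<le> n" for n x y
    using that
  proof (induction n arbitrary: x rule: less_induct)
    case (less n)
    show ?case
    proof (cases "n \<le> 2 * N")
      case True
      then show ?thesis
        unfolding chain_iff_tranclp using less.prems by (blast intro: step)
    next
      case False
      then have "(pseudo_step (\<Psi> 1) \<delta> ^^ (N + (n - N))) x y"
        using less.prems by simp
      then obtain z where z: "(pseudo_step (\<Psi> 1) \<delta> ^^ N) x z" "(pseudo_step (\<Psi> 1) \<delta> ^^ (n - N)) z y"
        unfolding relpowp_add by blast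
      have "chain \<Psi> \<epsilon> T z y"
        using z(2) False N(1) by (intro less.IH[of "n - N"]) auto
      moreover have "flow_step \<Psi> \<epsilon> T x z"
        using z(1) by (rule step) auto
      ultimately show ?thesis
        unfolding chain_iff_tranclp by (rule tranclp_into_tranclp2[rotated])
    qed
  qed
  obtain k where k: "k > 0" "(pseudo_step (\<Psi> 1) \<delta> ^^ k) x x"
    using xx \<delta>(1) unfolding reaches_def tranclp_power by blast
  obtain m where m: "(pseudo_step (\<Psi> 1) \<delta> ^^ m) x y"
    using xy \<delta>(1) unfolding reaches_def tranclp_power by blast
  \<comment> \<open>Since \<open>k\<close> is positive, \<open>N\<close> turns around the loop give
    at least \<open>N\<close> steps.\<close>
  have "(pseudo_step (\<Psi> 1) \<delta> ^^ (j * k)) x x" for j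
    by (induction j) (use k(2) in \<open>auto simp: relpowp_add\<close>)
  with m have "(pseudo_step (\<Psi> 1) \<delta> ^^ (N * k + m)) x y"
    unfolding relpowp_add by blast
  then show ?thesis
    using k(1) by (intro chain) (auto intro: trans_le_add1)
qed

lemma int_ChRec_iff:
  fixes \<Psi> :: "int \<Rightarrow> 'a::metric_space \<Rightarrow> 'a"
  assumes "topological_semiflow \<Psi>"
  shows "x \<in> ChRec \<Psi> \<longleftrightarrow> reaches (\<Psi> 1) x x"
proof
  assume "x \<in> ChRec \<Psi>"
  then show "reaches (\<Psi> 1) x x"
    unfolding ChRec_def chain_recurrent_def reaches_def
    using int_chain_imp_pseudo_steps[OF assms _ zero_less_one] by fastforce
next
  assume "reaches (\<Psi> 1) x x"
  then show "x \<in> ChRec \<Psi>"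
    unfolding ChRec_def chain_recurrent_def using reaches_imp_int_chain[OF assms] by blast
qed

lemma int_chain_equivalent_iff:
  fixes \<Psi> :: "int \<Rightarrow> 'a::metric_space \<Rightarrow> 'a"
  assumes "topological_semiflow \<Psi>"
  shows "chain_equivalent \<Psi> x y \<longleftrightarrow> reaches (\<Psi> 1) x y \<and> reaches (\<Psi> 1) y x"
proof
  assume "chain_equivalent \<Psi> x y"
  then show "reaches (\<Psi> 1) x y \<and> reaches (\<Psi> 1) y x"
    unfolding chain_equivalent_def reaches_def
    using int_chain_imp_pseudo_steps[OF assms _ zero_less_one] by fastforce
next
  assume *: "reaches (\<Psi> 1) x y \<and> reaches (\<Psi> 1) y x"
  then have "reaches (\<Psi> 1) x x" "reaches (\<Psi> 1) y y"
    by (blast intro: reaches_trans)+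
  with * show "chain_equivalent \<Psi> x y"
    unfolding chain_equivalent_def using reaches_imp_int_chain[OF assms] by blast
qed

subsection \<open>Chains of a continuous-time semiflow\<close>

text \<open>The index is the total flow time, which \<open>chain\<close> does not record. Links are
  appended at the end because sampling proceeds forward in time.\<close>

inductive timed_chain ::
  "(real \<Rightarrow> 'a::metric_space \<Rightarrow> 'a) \<Rightarrow> ('a \<Rightarrow> real) \<Rightarrow> real \<Rightarrow> 'a \<Rightarrow> 'a \<Rightarrow> bool"
  for \<Phi> \<epsilon> where
  single: "t \<ge> 1 \<Longrightarrow> dist (\<Phi> t x) y < \<epsilon> (\<Phi> t x) \<Longrightarrow> timed_chain \<Phi> \<epsilon> t x y"
| snoc: "timed_chain \<Phi> \<epsilon> \<tau> x y \<Longrightarrow> t \<ge> 1 \<Longrightarrow> dist (\<Phi> t y) z < \<epsilon> (\<Phi> t y) \<Longrightarrow>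
    timed_chain \<Phi> \<epsilon> (\<tau> + t) x z"

lemma timed_chain_append:
  assumes "timed_chain \<Phi> \<epsilon> \<sigma> y z" "timed_chain \<Phi> \<epsilon> \<tau> x y"
  shows "timed_chain \<Phi> \<epsilon> (\<tau> + \<sigma>) x z"
  using assms
proof induction
  case (single t y z)
  then show ?case by (intro timed_chain.snoc)
next
  case (snoc \<sigma> y z t w)
  from timed_chain.snoc[OF snoc.IH[OF snoc.prems] snoc.hyps(2,3)] show ?case
    by (simp add: add.assoc)
qed

lemma timed_chain_repeat:
  assumes "timed_chain \<Phi> \<epsilon> \<tau> x x" "n > 0"
  shows "timed_chain \<Phi> \<epsilon> (real n * \<tau>) x x"
  using assms(2)
proof (induction n rule: nat_induct_non_zero)
  case 1
  with assms(1) show ?case by simp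
next
  case (Suc n)
  from timed_chain_append[OF assms(1) Suc.IH] show ?case
    by (simp add: algebra_simps)
qed

lemma chain_imp_timed_chain:
  assumes "chain \<Phi> \<epsilon> 1 x y"
  shows "\<exists>\<tau>. timed_chain \<Phi> \<epsilon> \<tau> x y"
proof -
  from assms have "(flow_step \<Phi> \<epsilon> 1)\<^sup>+\<^sup>+ x y"
    by (simp add: chain_iff_tranclp)
  then show ?thesis
    by induction (auto simp: flow_step_def intro: timed_chain.intros)
qed

lemma semiflow_add:
  "topological_semiflow \<Phi> \<Longrightarrow> s \<ge> 0 \<Longrightarrow> t \<ge> 0 \<Longrightarrow> \<Phi> s (\<Phi> t x) = \<Phi> (s + t) x"
  by (simp add: topological_semiflow_def)

lemma semiflow_funpow:
  fixes \<Phi> :: "real \<Rightarrow> 'a::metric_space \<Rightarrow> 'a"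
  assumes "topological_semiflow \<Phi>"
  shows "\<Phi> (real n) x = (\<Phi> 1 ^^ n) x"
  using topological_semiflow_int_funpow[OF topological_semiflow_time_one[OF assms], of n x]
  by simp

lemma semiflow_continuous_time:
  fixes \<Phi> :: "real \<Rightarrow> 'a::metric_space \<Rightarrow> 'a"
  assumes "topological_semiflow \<Phi>"
  shows "continuous_on {0..} (\<lambda>s. \<Phi> s x)"
proof -
  have "continuous_on ({0..} \<times> UNIV) (\<lambda>(t, x). \<Phi> t x)"
    using assms by (simp add: topological_semiflow_def)
  from continuous_on_compose2[OF this, of "{0..}" "\<lambda>s. (s, x)"] show ?thesis
    by (force intro: continuous_intros)
qed

text \<open>The chain is sampled at integer times: as every segment lasts at least one time unit, at most
  one jump happens between two consecutive samples.\<close>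

lemma sample_timed_chain:
  fixes \<Phi> :: "real \<Rightarrow> 'a::metric_space \<Rightarrow> 'a"
  assumes \<Phi>: "topological_semiflow \<Phi>" and \<epsilon>: "error_function \<epsilon>"
  shows "\<exists>\<delta>. error_function \<delta> \<and> (\<forall>\<tau> x y s N. timed_chain \<Phi> \<delta> \<tau> x y \<longrightarrow> s \<ge> 0 \<longrightarrow> \<tau> + s = real N \<longrightarrow>
    (pseudo_step (\<Phi> 1) \<epsilon>)\<^sup>+\<^sup>+ x (\<Phi> s y))"
proof -
  have "continuous_on ({0..} \<times> UNIV) (\<lambda>(t, x). \<Phi> t x)"
    using \<Phi> by (simp add: topological_semiflow_def)
  then have "continuous_on ({0..1} \<times> UNIV) (\<lambda>(t, x). \<Phi> t x)"
    by (rule continuous_on_subset) auto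
  from error_function_modulus[OF _ _ this \<epsilon>]
  obtain \<delta> where \<delta>: "error_function \<delta>"
    "\<And>w y s. dist w y < \<delta> w \<Longrightarrow> 0 \<le> s \<Longrightarrow> s \<le> 1 \<Longrightarrow> dist (\<Phi> s w) (\<Phi> s y) < \<epsilon> (\<Phi> s w)"
    by auto
  \<comment> \<open>The remainder lies in \<open>(0, 1]\<close>, so an integer time has remainder 1
    and the jump always comes strictly after the last sample.\<close>
  have split: "\<exists>m \<rho>. 0 < \<rho> \<and> \<rho> \<le> 1 \<and> t = real m + \<rho>" if "t > 0" for t
    using that by (intro exI[of _ "nat (\<lceil>t\<rceil> - 1)"] exI[of _ "t - real (nat (\<lceil>t\<rceil> - 1))"])
      (auto simp: of_nat_nat; linarith)
  have flow: "(pseudo_step (\<Phi> 1) \<epsilon>)\<^sup>*\<^sup>* x (\<Phi> (real m) x)" for m x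
    unfolding semiflow_funpow[OF \<Phi>] by (rule pseudo_step_funpow[OF \<epsilon>])
  \<comment> \<open>A jump at time \<open>\<rho>\<close> after the sample \<open>z\<close> is
    carried by the flow to the next integer time, where \<open>\<delta>\<close> keeps it below
    \<open>\<epsilon>\<close>.\<close>
  have jump: "pseudo_step (\<Phi> 1) \<epsilon> z (\<Phi> (1 - \<rho>) y)"
    if "0 < \<rho>" "\<rho> \<le> 1" "dist (\<Phi> \<rho> z) y < \<delta> (\<Phi> \<rho> z)" for \<rho> z y
    using \<delta>(2)[OF that(3), of "1 - \<rho>"] that(1,2) by (simp add: pseudo_step_def semiflow_add[OF \<Phi>])
  \<comment> \<open>Invariant of the sampling: \<open>z\<close> is the last sample before the final
    jump, which happens \<open>\<rho>\<close> later.\<close>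
  have sample: "\<exists>m \<rho> z. 0 < \<rho> \<and> \<rho> \<le> 1 \<and> \<tau> = real m + \<rho> \<and> (pseudo_step (\<Phi> 1) \<epsilon>)\<^sup>*\<^sup>* x z \<and>
      dist (\<Phi> \<rho> z) y < \<delta> (\<Phi> \<rho> z)" if "timed_chain \<Phi> \<delta> \<tau> x y" for \<tau> x y
    using that
  proof induction
    case (single t x y)
    then obtain m \<rho> where m: "0 < \<rho>" "\<rho> \<le> 1" "t = real m + \<rho>"
      using split[of t] by auto
    then have "\<Phi> \<rho> (\<Phi> (real m) x) = \<Phi> t x"
      using semiflow_add[OF \<Phi>, of \<rho> "real m"] by (simp add: add.commute)
    with m single flow[of x m] show ?case by metis
  next
    case (snoc \<tau> x y t y')
    then obtain m \<rho> z where z: "0 < \<rho>" "\<rho> \<le> 1" "\<tau> = real m + \<rho>" "(pseudo_step (\<Phi> 1) \<epsilon>)\<^sup>*\<^sup>* x z"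
      "dist (\<Phi> \<rho> z) y < \<delta> (\<Phi> \<rho> z)"
      by blast
    \<comment> \<open>The next sample comes \<open>1 - \<rho>\<close> after the jump; as the new
      link lasts at least 1, its own jump lies strictly beyond that sample.\<close>
    have "t - (1 - \<rho>) > 0"
      using snoc.hyps z by simp
    then obtain m' \<rho>' where m': "0 < \<rho>'" "\<rho>' \<le> 1" "t - (1 - \<rho>) = real m' + \<rho>'"
      using split by blast
    define z' where "z' = \<Phi> (real m') (\<Phi> (1 - \<rho>) y)"
    have "(pseudo_step (\<Phi> 1) \<epsilon>)\<^sup>*\<^sup>* x (\<Phi> (1 - \<rho>) y)"
      using z(4) jump[OF z(1,2,5)] by (rule rtranclp.rtrancl_into_rtrancl)
    then have "(pseudo_step (\<Phi> 1) \<epsilon>)\<^sup>*\<^sup>* x z'"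
      using flow unfolding z'_def by (rule rtranclp_trans)
    moreover have "\<Phi> \<rho>' z' = \<Phi> t y"
    proof -
      have "\<rho>' + (real m' + (1 - \<rho>)) = t"
        using m' by simp
      moreover have "\<Phi> \<rho>' z' = \<Phi> (\<rho>' + (real m' + (1 - \<rho>))) y"
        using m'(1) z(2) unfolding z'_def by (simp add: semiflow_add[OF \<Phi>])
      ultimately show ?thesis
        by (simp only:)
    qed
    moreover have "\<tau> + t = real (m + m' + 1) + \<rho>'"
      using m' z by simp
    ultimately show ?case
      using m'(1,2) snoc.hyps by metis
  qed
  have "(pseudo_step (\<Phi> 1) \<epsilon>)\<^sup>+\<^sup>+ x (\<Phi> s y)"
    if tc: "timed_chain \<Phi> \<delta> \<tau> x y" "s \<ge> 0" "\<tau> + s = real N" for \<tau> x y s N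
  proof -
    obtain m \<rho> z where z: "0 < \<rho>" "\<rho> \<le> 1" "\<tau> = real m + \<rho>" "(pseudo_step (\<Phi> 1) \<epsilon>)\<^sup>*\<^sup>* x z"
      "dist (\<Phi> \<rho> z) y < \<delta> (\<Phi> \<rho> z)"
      using sample[OF tc(1)] by blast
    have "real m < real N"
      using z tc by simp
    \<comment> \<open>One step from \<open>z\<close> absorbs the final jump, and
      \<open>N - m - 1\<close> exact steps remain.\<close>
    then have "real N = real (N - m - 1) + real m + 1"
      by simp
    then have "s = real (N - m - 1) + (1 - \<rho>)"
      using z(3) tc(3) by linarith
    then have "\<Phi> s y = \<Phi> (real (N - m - 1)) (\<Phi> (1 - \<rho>) y)"
      using semiflow_add[OF \<Phi>, of "real (N - m - 1)" "1 - \<rho>" y] z(2) by simp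
    then have "(pseudo_step (\<Phi> 1) \<epsilon>)\<^sup>*\<^sup>* (\<Phi> (1 - \<rho>) y) (\<Phi> s y)"
      using flow by simp
    then show ?thesis
      using z(4) jump[OF z(1,2,5)] by (meson rtranclp_into_tranclp1 tranclp_rtranclp_tranclp)
  qed
  with \<delta>(1) show ?thesis by blast
qed

text \<open>Dirichlet approximation brings a multiple of \<open>\<tau>\<close> near an integer, on
  either side. The side matters, since the missing time \<open>s\<close> has to be flowed forward;
  an excess \<open>e > 0\<close> is repeated until it nearly fills a whole unit from below.\<close>

lemma multiple_just_below_integer:
  fixes \<tau> \<eta> :: real
  assumes "\<tau> > 0" "\<eta> > 0"
  shows "\<exists>n>0. \<exists>s N. 0 \<le> s \<and> s < \<eta> \<and> real n * \<tau> + s = real N"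
proof -
  obtain M where M: "M > 0" "1 / real M < \<eta>"
    using assms(2) by (metis nat_approx_posE of_nat_0_less_iff of_nat_Suc zero_less_Suc)
  obtain h k where k: "0 < k" "\<bar>of_int k * \<tau> - of_int h\<bar> < 1 / real M"
    using Dirichlet_approx[OF M(1)] by metis
  define e where "e = of_int k * \<tau> - of_int h"
  define n where "n = nat k"
  have n: "n > 0" "real n = of_int k"
    using k(1) by (auto simp: n_def)
  have e: "\<bar>e\<bar> < \<eta>" "real n * \<tau> = of_int h + e"
    using k(2) M(2) n by (auto simp: e_def)
  have "\<exists>n>0. \<exists>s. 0 \<le> s \<and> s < \<eta> \<and> real n * \<tau> + s \<in> \<int>"
  proof (cases "e \<le> 0")
    case True
    then have "real n * \<tau> + (- e) \<in> \<int>"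
      using e(2) by simp
    with True e(1) n(1) show ?thesis
      by (intro exI[of _ n] conjI exI[of _ "- e"]) auto
  next
    case False
    \<comment> \<open>With this \<open>q\<close> the total excess \<open>q * e\<close> lies in
      \<open>(1 - e, 1]\<close>, so less than \<open>e\<close> is missing to the next
      integer.\<close>
    define q where "q = nat \<lfloor>1 / e\<rfloor>"
    have "1 / real M \<le> 1"
      using M(1) by simp
    then have "e > 0" "e \<le> 1"
      using False k(2) unfolding e_def by linarith+
    then have "1 / e \<ge> 1"
      by simp
    then have q: "q > 0" "real q \<le> 1 / e" "1 / e < real q + 1"
      unfolding q_def by linarith+
    then have "real q * e \<le> 1" "1 < real q * e + e"
      using \<open>e > 0\<close> by (auto simp: field_simps)
    moreover have "real (q * n) * \<tau> + (1 - real q * e) = of_int (int q * h + 1)"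
      unfolding of_nat_mult mult.assoc e(2) by (simp add: algebra_simps)
    then have "real (q * n) * \<tau> + (1 - real q * e) \<in> \<int>"
      by (metis Ints_of_int)
    ultimately show ?thesis
      using q(1) n(1) e(1)
      by (intro exI[of _ "q * n"] conjI exI[of _ "1 - real q * e"]) auto
  qed
  then obtain n s where ns: "n > 0" "0 \<le> s" "s < \<eta>" "real n * \<tau> + s \<in> \<int>"
    by blast
  obtain j where j: "real n * \<tau> + s = of_int j"
    using ns(4) by (rule Ints_cases)
  have "real n * \<tau> + s \<ge> 0"
    using ns(2) assms(1) by simp
  then have "real n * \<tau> + s = real (nat j)"
    using j by simp
  with ns(1-3) show ?thesis by blast
qed

text \<open>A loop is repeated until its total time falls just short of an integer. Sampling then
  ends at \<open>\<Phi> s x\<close> with \<open>s\<close> small, and moving the end point closes the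
  pseudo-orbit.\<close>

lemma recurrent_reaches_self:
  fixes \<Phi> :: "real \<Rightarrow> 'a::metric_space \<Rightarrow> 'a"
  assumes \<Phi>: "topological_semiflow \<Phi>" and x: "x \<in> ChRec \<Phi>"
  shows "reaches (\<Phi> 1) x x"
  unfolding reaches_def
proof (intro allI impI)
  fix \<epsilon> :: "'a \<Rightarrow> real" assume "error_function \<epsilon>"
  then obtain \<epsilon>' where \<epsilon>': "error_function \<epsilon>'" "\<And>x y y'. (pseudo_step (\<Phi> 1) \<epsilon>')\<^sup>+\<^sup>+ x y \<Longrightarrow>
      dist y y' < \<epsilon>' y \<Longrightarrow> (pseudo_step (\<Phi> 1) \<epsilon>)\<^sup>+\<^sup>+ x y'"
    using pseudo_step_move_end by metis
  obtain \<delta> where \<delta>: "error_function \<delta>"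
    "\<And>\<tau> x y s N. timed_chain \<Phi> \<delta> \<tau> x y \<Longrightarrow> s \<ge> 0 \<Longrightarrow> \<tau> + s = real N \<Longrightarrow>
      (pseudo_step (\<Phi> 1) \<epsilon>')\<^sup>+\<^sup>+ x (\<Phi> s y)"
    using sample_timed_chain[OF \<Phi> \<epsilon>'(1)] by blast
  have "chain \<Phi> \<delta> 1 x x"
    using x \<delta>(1) by (simp add: ChRec_def chain_recurrent_def)
  then obtain \<tau> where \<tau>: "timed_chain \<Phi> \<delta> \<tau> x x"
    using chain_imp_timed_chain by blast
  then have "\<tau> > 0"
    by induction auto
  \<comment> \<open>The end point is moved from \<open>\<Phi> s x\<close> to \<open>x\<close>, so
    the tolerance is taken at \<open>\<Phi> s x\<close>; positivity of \<open>G\<close> is exactly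
    what is needed.\<close>
  define G where "G s = \<epsilon>' (\<Phi> s x) - dist (\<Phi> s x) x" for s
  have "continuous_on {0..} G"
    unfolding G_def using \<epsilon>'(1)
    by (auto intro!: continuous_intros semiflow_continuous_time[OF \<Phi>]
          continuous_on_compose2[of UNIV \<epsilon>'] simp: error_function_def)
  moreover have "G 0 > 0"
    using \<Phi> \<epsilon>'(1) by (simp add: G_def topological_semiflow_def error_function_def)
  ultimately obtain \<eta> where "\<eta> > 0" "\<forall>s\<in>{0..}. dist s 0 < \<eta> \<longrightarrow> dist (G s) (G 0) < G 0"
    unfolding continuous_on_iff by (metis atLeast_iff order_refl)
  then have \<eta>: "\<eta> > 0" "\<And>s. 0 \<le> s \<Longrightarrow> s < \<eta> \<Longrightarrow> G s > 0"
    by (auto simp: dist_real_def abs_less_iff)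
  obtain n s N where ns: "n > 0" "0 \<le> s" "s < \<eta>" "real n * \<tau> + s = real N"
    using multiple_just_below_integer[OF \<open>\<tau> > 0\<close> \<eta>(1)] by blast
  have "(pseudo_step (\<Phi> 1) \<epsilon>')\<^sup>+\<^sup>+ x (\<Phi> s x)"
    using \<delta>(2) timed_chain_repeat[OF \<tau> ns(1)] ns by blast
  moreover have "dist (\<Phi> s x) x < \<epsilon>' (\<Phi> s x)"
    using \<eta>(2)[OF ns(2,3)] by (simp add: G_def)
  ultimately show "(pseudo_step (\<Phi> 1) \<epsilon>)\<^sup>+\<^sup>+ x x"
    by (rule \<epsilon>'(2))
qed

lemma reaches_flow:
  fixes \<Phi> :: "real \<Rightarrow> 'a::metric_space \<Rightarrow> 'a"
  assumes \<Phi>: "topological_semiflow \<Phi>" and "s \<ge> 0" and "reaches (\<Phi> 1) x y"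
  shows "reaches (\<Phi> 1) (\<Phi> s x) (\<Phi> s y)"
  using topological_semiflow_continuous[OF \<Phi> \<open>s \<ge> 0\<close>] _ assms(3)
proof (rule reaches_image)
  show "\<Phi> s (\<Phi> 1 u) = \<Phi> 1 (\<Phi> s u)" for u
    using \<open>s \<ge> 0\<close> by (simp add: semiflow_add[OF \<Phi>] add.commute)
qed

text \<open>Each orbit point reaches itself, hence also its neighbours after a small move of the end
  point. For fixed \<open>\<epsilon>\<close> mutual reachability is therefore a locally satisfied
  equivalence relation on the connected half-line of times, so it relates all of them.\<close>

lemma reaches_along_orbit:
  fixes \<Phi> :: "real \<Rightarrow> 'a::metric_space \<Rightarrow> 'a"
  assumes \<Phi>: "topological_semiflow \<Phi>" and x: "reaches (\<Phi> 1) x x" and st: "s \<ge> 0" "t \<ge> 0"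
  shows "reaches (\<Phi> 1) (\<Phi> s x) (\<Phi> t x)"
  unfolding reaches_def
proof (intro allI impI)
  fix \<epsilon> :: "'a \<Rightarrow> real" assume "error_function \<epsilon>"
  then obtain \<delta> where \<delta>: "error_function \<delta>" "\<And>x y y'. (pseudo_step (\<Phi> 1) \<delta>)\<^sup>+\<^sup>+ x y \<Longrightarrow>
      dist y y' < \<delta> y \<Longrightarrow> (pseudo_step (\<Phi> 1) \<epsilon>)\<^sup>+\<^sup>+ x y'"
    using pseudo_step_move_end by metis
  have near: "(pseudo_step (\<Phi> 1) \<epsilon>)\<^sup>+\<^sup>+ (\<Phi> a x) (\<Phi> b x)"
    if "a \<ge> 0" "dist (\<Phi> a x) (\<Phi> b x) < \<delta> (\<Phi> a x)" for a b
    using \<delta>(2) that(2) reaches_flow[OF \<Phi> that(1) x] \<delta>(1) unfolding reaches_def by blast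
  define R where "R a b \<longleftrightarrow> (pseudo_step (\<Phi> 1) \<epsilon>)\<^sup>+\<^sup>+ (\<Phi> a x) (\<Phi> b x) \<and>
    (pseudo_step (\<Phi> 1) \<epsilon>)\<^sup>+\<^sup>+ (\<Phi> b x) (\<Phi> a x)" for a b
  have \<delta>c: "continuous_on {0..} (\<lambda>b. \<delta> (\<Phi> b x))"
    using \<delta>(1) by (auto intro!: semiflow_continuous_time[OF \<Phi>]
      continuous_on_compose2[of UNIV \<delta>] simp: error_function_def)
  have "R s t"
  proof (rule connected_equivalence_relation[of "{0..}" s t R])
    fix a :: real assume a: "a \<in> {0..}"
    \<comment> \<open>The minimum of the two tolerances allows the move in both directions.\<close>
    define T where "T = {b \<in> {0..}. dist (\<Phi> a x) (\<Phi> b x) < min (\<delta> (\<Phi> a x)) (\<delta> (\<Phi> b x))}"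
    have "continuous_on {0..} (\<lambda>b. min (\<delta> (\<Phi> a x)) (\<delta> (\<Phi> b x)) - dist (\<Phi> a x) (\<Phi> b x))"
      by (intro continuous_intros continuous_on_min \<delta>c semiflow_continuous_time[OF \<Phi>])
    from continuous_openin_preimage_gen[OF this open_greaterThan[of 0]]
    have "openin (top_of_set {0..}) T"
      by (rule back_subst[where P = "openin _"]) (auto simp: T_def)
    moreover have "a \<in> T"
      using a \<delta>(1) by (simp add: T_def error_function_def)
    moreover have "R a b" if "b \<in> T" for b
      using near[of a b] near[of b a] that a unfolding R_def T_def by (simp add: dist_commute)
    ultimately show "\<exists>T. openin (top_of_set {0..}) T \<and> a \<in> T \<and> (\<forall>b\<in>T. R a b)"
      by blast
  qed (use st in \<open>auto simp: R_def intro: tranclp_trans\<close>)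
  then show "(pseudo_step (\<Phi> 1) \<epsilon>)\<^sup>+\<^sup>+ (\<Phi> s x) (\<Phi> t x)"
    by (simp add: R_def)
qed

text \<open>Sampling a chain up to the next integer time ends at \<open>\<Phi> s y\<close>. As
  \<open>y\<close> is recurrent, its orbit lies in one class of the time-one map, so
  \<open>\<Phi> s y\<close> reaches \<open>y\<close>.\<close>

lemma chain_equivalent_imp_reaches:
  fixes \<Phi> :: "real \<Rightarrow> 'a::metric_space \<Rightarrow> 'a"
  assumes \<Phi>: "topological_semiflow \<Phi>" and xy: "chain_equivalent \<Phi> x y"
  shows "reaches (\<Phi> 1) x y"
  unfolding reaches_def
proof (intro allI impI)
  fix \<epsilon> :: "'a \<Rightarrow> real" assume \<epsilon>: "error_function \<epsilon>"
  obtain \<delta> where \<delta>: "error_function \<delta>"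
    "\<And>\<tau> x y s N. timed_chain \<Phi> \<delta> \<tau> x y \<Longrightarrow> s \<ge> 0 \<Longrightarrow> \<tau> + s = real N \<Longrightarrow>
      (pseudo_step (\<Phi> 1) \<epsilon>)\<^sup>+\<^sup>+ x (\<Phi> s y)"
    using sample_timed_chain[OF \<Phi> \<epsilon>] by blast
  have "chain \<Phi> \<delta> 1 x y"
    using xy \<delta>(1) by (simp add: chain_equivalent_def)
  then obtain \<tau> where \<tau>: "timed_chain \<Phi> \<delta> \<tau> x y"
    using chain_imp_timed_chain by blast
  define s where "s = real (nat \<lceil>\<tau>\<rceil>) - \<tau>"
  have s: "s \<ge> 0" "\<tau> + s = real (nat \<lceil>\<tau>\<rceil>)"
    unfolding s_def by linarith+
  have "y \<in> ChRec \<Phi>"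
    using chain_equivalent_imp_ChRec[OF xy] by simp
  then have "reaches (\<Phi> 1) (\<Phi> s y) (\<Phi> 0 y)"
    using recurrent_reaches_self[OF \<Phi>] s by (intro reaches_along_orbit[OF \<Phi>]) auto
  then have "(pseudo_step (\<Phi> 1) \<epsilon>)\<^sup>+\<^sup>+ (\<Phi> s y) y"
    using \<epsilon> \<Phi> by (simp add: reaches_def topological_semiflow_def)
  with \<delta>(2)[OF \<tau> s] show "(pseudo_step (\<Phi> 1) \<epsilon>)\<^sup>+\<^sup>+ x y"
    by (rule tranclp_trans)
qed

section \<open>Agreement of the chain relations for the semiflow and its time-one map\<close>

lemma int_chain_imp_real_chain:
  fixes \<Phi> :: "real \<Rightarrow> 'a::metric_space \<Rightarrow> 'a" and T :: real
  assumes "chain (\<lambda>n::int. \<Phi> (of_int n)) \<epsilon> \<lceil>T\<rceil> x y"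
  shows "chain \<Phi> \<epsilon> T x y"
proof -
  have "flow_step \<Phi> \<epsilon> T u v" if "flow_step (\<lambda>n::int. \<Phi> (of_int n)) \<epsilon> \<lceil>T\<rceil> u v" for u v
    using that unfolding flow_step_def by (auto simp: ceiling_le_iff)
  note step = this
  from assms show ?thesis
    unfolding chain_iff_tranclp by induction (auto intro: step tranclp.intros)
qed

lemma chain_equivalent_time_one:
  fixes \<Phi> :: "real \<Rightarrow> 'a::metric_space \<Rightarrow> 'a"
  assumes \<Phi>: "topological_semiflow \<Phi>"
  shows "chain_equivalent (\<lambda>n::int. \<Phi> (of_int n)) x y \<longleftrightarrow> chain_equivalent \<Phi> x y"
proof
  assume "chain_equivalent (\<lambda>n::int. \<Phi> (of_int n)) x y"
  then show "chain_equivalent \<Phi> x y"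
    unfolding chain_equivalent_def by (simp add: int_chain_imp_real_chain)
next
  assume "chain_equivalent \<Phi> x y"
  moreover from this have "chain_equivalent \<Phi> y x"
    by (simp add: chain_equivalent_def)
  ultimately show "chain_equivalent (\<lambda>n::int. \<Phi> (of_int n)) x y"
    using chain_equivalent_imp_reaches[OF \<Phi>]
    by (simp add: int_chain_equivalent_iff[OF topological_semiflow_time_one[OF \<Phi>]])
qed

lemma ChRec_iff_chain_equivalent: "x \<in> ChRec \<Phi> \<longleftrightarrow> chain_equivalent \<Phi> x x"
  by (auto simp: ChRec_def chain_recurrent_def chain_equivalent_def)

lemma ChRec_time_one:
  fixes \<Phi> :: "real \<Rightarrow> 'a::metric_space \<Rightarrow> 'a"
  assumes "topological_semiflow \<Phi>"
  shows "ChRec (\<lambda>n::int. \<Phi> (of_int n)) = ChRec \<Phi>"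
  using chain_equivalent_time_one[OF assms] by (auto simp: ChRec_iff_chain_equivalent)

subsection \<open>Complete Lyapunov functions\<close>

text \<open>The open set where \<open>g < 1\<close> is a trapping region: its image lies in the
  closed set where \<open>g = 0\<close>. Values strictly between 0 and 1 mark its transient boundary
  layer.\<close>

definition level_function :: "('a::topological_space \<Rightarrow> 'a) \<Rightarrow> ('a \<Rightarrow> real) \<Rightarrow> bool" where
  "level_function f g \<longleftrightarrow> continuous_on UNIV g \<and> (\<forall>x. 0 \<le> g x \<and> g x \<le> 1) \<and>
    (\<forall>x. g x < 1 \<longrightarrow> g (f x) = 0)"

lemma level_function_decreasing: "level_function f g \<Longrightarrow> g (f x) \<le> g x"
  unfolding level_function_def by (metis linorder_not_less order_less_le)

text \<open>Jumps are kept so small that each raises \<open>g\<close> by less than \<open>e\<close>.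
  Errors do not accumulate: a point with \<open>g < c\<close> is mapped to level 0, so the next
  value is below \<open>e\<close>, which is at most \<open>c\<close>.\<close>

lemma level_function_reaches:
  assumes g: "level_function f g" and xy: "reaches f x y" and c: "g (f x) < c" "c \<le> 1"
  shows "g y < c"
proof -
  define e where "e = c - g (f x)"
  have e: "e > 0" "e \<le> c"
    using c g by (auto simp: e_def level_function_def)
  have "continuous_on UNIV g" "error_function (\<lambda>_::real. e)"
    using g e(1) by (auto simp: level_function_def error_function_def)
  then obtain \<epsilon> where \<epsilon>: "error_function \<epsilon>" "\<And>w y. dist w y < \<epsilon> w \<Longrightarrow> dist (g w) (g y) < e"
    using error_function_modulus_map by blast
  have step: "g v < g (f u) + e" if "pseudo_step f \<epsilon> u v" for u v
    using \<epsilon>(2)[of "f u" v] that by (auto simp: pseudo_step_def dist_real_def)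
  have "(pseudo_step f \<epsilon>)\<^sup>+\<^sup>+ x y"
    using xy \<epsilon>(1) by (simp add: reaches_def)
  then show ?thesis
  proof induction
    case (base y)
    then show ?case
      using step[of x y] by (simp add: e_def)
  next
    case (step u v)
    then have "g (f u) = 0"
      using g c(2) by (simp add: level_function_def)
    then show ?case
      using \<open>pseudo_step f \<epsilon> u v\<close>[THEN \<open>\<And>u v. pseudo_step f \<epsilon> u v \<Longrightarrow> g v < g (f u) + e\<close>] e(2) by simp
  qed
qed

text \<open>A strict drop at \<open>x\<close> would, with threshold \<open>g x\<close>, give
  \<open>g x < g x\<close>. Once \<open>g\<close> is constant along the step, a value below 1 has to
  be 0.\<close>

lemma level_function_recurrent:
  assumes g: "level_function f g" and x: "reaches f x x"
  shows "g (f x) = g x" and "g x = 0 \<or> g x = 1"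
proof -
  show *: "g (f x) = g x"
    using level_function_reaches[OF g x, of "g x"] level_function_decreasing[OF g, of x] g
    by (fastforce simp: level_function_def)
  show "g x = 0 \<or> g x = 1"
    using g * unfolding level_function_def by (metis order_less_le)
qed

text \<open>Only \<open>g x = 0\<close> needs an argument: threshold 1 gives \<open>g y < 1\<close>,
  and recurrence leaves only the value 0.\<close>

lemma level_function_reaches_le:
  assumes g: "level_function f g" and "reaches f x x" "reaches f y y" "reaches f x y"
  shows "g y \<le> g x"
proof (cases "g x = 0")
  case True
  then have "g y < 1"
    using level_function_recurrent(1)[OF g assms(2)] by (intro level_function_reaches[OF g assms(4)]) auto
  then show ?thesis
    using level_function_recurrent(2)[OF g assms(3)] True by simp
next
  case False
  then show ?thesis
    using level_function_recurrent(2)[OF g assms(2)] g by (simp add: level_function_def)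
qed

text \<open>The set \<open>V\<close> of points reached from \<open>x\<close> by \<open>\<epsilon>\<close>-pseudo-orbits contains the closure of its
  image; \<open>g\<close> is a Urysohn function for that closure and the complement of \<open>V\<close>.\<close>

lemma level_function_exists:
  fixes f :: "'a::metric_space \<Rightarrow> 'a"
  assumes "\<not> reaches f x y"
  shows "\<exists>g. level_function f g \<and> g (f x) = 0 \<and> g y = 1"
proof -
  obtain \<epsilon> where \<epsilon>: "error_function \<epsilon>" and xy: "\<not> (pseudo_step f \<epsilon>)\<^sup>+\<^sup>+ x y"
    using assms by (auto simp: reaches_def)
  define V where "V = {z. (pseudo_step f \<epsilon>)\<^sup>+\<^sup>+ x z}"
  \<comment> \<open>The point \<open>x\<close> itself may lie outside \<open>V\<close>, so
    \<open>f x\<close> is added to obtain \<open>g (f x) = 0\<close>.\<close>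
  define A where "A = closure (insert (f x) (f ` V))"
  define B where "B = closure (- V)"
  have \<epsilon>c: "isCont \<epsilon> z" for z
    using \<epsilon> by (simp add: error_function_def continuous_on_eq_continuous_at)
  have ball: "z \<in> V" if "w \<in> insert (f x) (f ` V)" "dist w z < \<epsilon> w" for w z
    using that unfolding V_def
    by (auto simp: pseudo_step_def intro: tranclp.r_into_trancl tranclp.trancl_into_trancl)
  \<comment> \<open>Around each \<open>w\<close> in the image the ball of radius
    \<open>\<epsilon> w\<close> stays in \<open>V\<close>. By continuity these radii are bounded
    below near a common limit \<open>z\<close>, which keeps points outside \<open>V\<close> away
    from it.\<close>
  have "A \<inter> B = {}"
  proof (rule ccontr)
    assume "A \<inter> B \<noteq> {}"
    then obtain z where z: "z \<in> closure (insert (f x) (f ` V))" "z \<in> closure (- V)"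
      unfolding A_def B_def by blast
    have "0 < \<epsilon> z / 2"
      using error_function_pos[OF \<epsilon>, of z] by simp
    then obtain r where r: "r > 0" "\<And>w. dist w z < r \<Longrightarrow> dist (\<epsilon> w) (\<epsilon> z) < \<epsilon> z / 2"
      using \<epsilon>c[of z] unfolding continuous_at_eps_delta by metis
    define \<rho> where "\<rho> = min r (\<epsilon> z / 4)"
    have "\<rho> > 0"
      using r(1) \<open>0 < \<epsilon> z / 2\<close> by (simp add: \<rho>_def)
    then obtain w v where w: "w \<in> insert (f x) (f ` V)" "dist w z < \<rho>" and v: "v \<in> - V" "dist v z < \<rho>"
      using z unfolding closure_approachable by metis
    have "\<epsilon> w > \<epsilon> z / 2"
      using r(2)[of w] w(2) unfolding \<rho>_def dist_real_def by linarith
    moreover have "dist w v < \<epsilon> z / 2"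
      using dist_triangle2[of w v z] w(2) v(2) by (simp add: \<rho>_def)
    ultimately have "v \<in> V"
      by (intro ball[OF w(1)]) simp
    with v(1) show False by simp
  qed
  have ne: "A \<noteq> {}" "B \<noteq> {}" "y \<in> B" "f x \<in> A"
    using xy closure_subset[of "- V"] closure_subset[of "insert (f x) (f ` V)"]
    by (auto simp: A_def B_def V_def)
  have zero: "infdist z A = 0 \<longleftrightarrow> z \<in> A" "infdist z B = 0 \<longleftrightarrow> z \<in> B" for z
    using in_closed_iff_infdist_zero[of A z] in_closed_iff_infdist_zero[of B z] ne
    by (auto simp: A_def B_def)
  define g where "g z = infdist z A / (infdist z A + infdist z B)" for z
  have pos: "infdist z A + infdist z B > 0" for z
    using zero[of z] \<open>A \<inter> B = {}\<close> infdist_nonneg[of z A] infdist_nonneg[of z B]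
    by (metis add_nonneg_eq_0_iff add_nonneg_nonneg disjoint_iff order_less_le)
  have "continuous_on UNIV g"
    unfolding g_def using pos by (intro continuous_intros) (metis less_irrefl)
  moreover have "0 \<le> g z" "g z \<le> 1" for z
    using pos[of z] by (auto simp: g_def infdist_nonneg divide_le_eq)
  moreover have "g (f z) = 0" if "g z < 1" for z
  proof -
    have "infdist z B \<noteq> 0"
      using that pos[of z] by (auto simp: g_def)
    then have "z \<in> V"
      using zero closure_subset[of "- V"] by (auto simp: B_def)
    then have "f z \<in> A"
      using closure_subset[of "insert (f x) (f ` V)"] unfolding A_def by blast
    then show ?thesis
      using zero by (simp add: g_def)
  qed
  moreover have "g (f x) = 0" "g y = 1"
    using ne zero pos[of y] by (auto simp: g_def)
  ultimately show ?thesis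
    unfolding level_function_def by blast
qed

section \<open>Existence in discrete time on separable spaces\<close>

text \<open>By continuity a strict inequality between \<open>g u\<close> and \<open>g v\<close>
  persists on small balls with centres in a countable dense set. One member of \<open>G\<close> is
  chosen for each pair of such balls; it may differ from \<open>g\<close> but still separates
  \<open>u\<close> from \<open>v\<close>.\<close>

lemma countable_subfamily_separating:
  fixes G :: "('a::metric_space \<Rightarrow> real) set"
  assumes X: "separable_space (euclidean :: 'a topology)"
    and G: "G \<noteq> {}" "\<And>g. g \<in> G \<Longrightarrow> continuous_on UNIV g"
  shows "\<exists>h :: nat \<Rightarrow> 'a \<Rightarrow> real. range h \<subseteq> G \<and>
    (\<forall>g\<in>G. \<forall>u v. g u < g v \<longrightarrow> (\<exists>n. h n u < h n v))"
proof -
  obtain D :: "'a set" where D: "countable D" "closure D = UNIV"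
    using X by (auto simp: separable_space_def)
  define sep where "sep a b n g \<longleftrightarrow>
    (\<forall>u v. dist a u < 1 / real (Suc n) \<longrightarrow> dist b v < 1 / real (Suc n) \<longrightarrow> g u < g v)"
    for a b :: 'a and n :: nat and g :: "'a \<Rightarrow> real"
  \<comment> \<open>If no member separates the two balls, any member of \<open>G\<close> is
    taken.\<close>
  define choice where "choice = (\<lambda>(a, b, n). SOME g. g \<in> G \<and> ((\<exists>g\<in>G. sep a b n g) \<longrightarrow> sep a b n g))"
  have choice: "choice (a, b, n) \<in> G \<and> ((\<exists>g\<in>G. sep a b n g) \<longrightarrow> sep a b n (choice (a, b, n)))" for a b n
  proof -
    have "\<exists>g. g \<in> G \<and> ((\<exists>g\<in>G. sep a b n g) \<longrightarrow> sep a b n g)"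
      using G(1) by (cases "\<exists>g\<in>G. sep a b n g") auto
    then show ?thesis
      unfolding choice_def prod.case by (rule someI_ex)
  qed
  define I where "I = D \<times> D \<times> (UNIV :: nat set)"
  have I: "countable I" "I \<noteq> {}"
    using D by (auto simp: I_def)
  have "\<exists>i\<in>I. choice i u < choice i v" if g: "g \<in> G" "g u < g v" for g u v
  proof -
    define e where "e = (g v - g u) / 2"
    have "e > 0"
      using g(2) by (simp add: e_def)
    obtain r where r: "r > 0" "\<And>w. dist w u < r \<Longrightarrow> dist (g w) (g u) < e"
      using G(2)[OF g(1)] \<open>e > 0\<close> unfolding continuous_on_iff by (metis UNIV_I)
    obtain s where s: "s > 0" "\<And>w. dist w v < s \<Longrightarrow> dist (g w) (g v) < e"
      using G(2)[OF g(1)] \<open>e > 0\<close> unfolding continuous_on_iff by (metis UNIV_I)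
    obtain n where n: "1 / real (Suc n) < min r s / 2"
      using r(1) s(1) nat_approx_posE[of "min r s / 2"] by auto
    obtain a b where ab: "a \<in> D" "dist a u < 1 / real (Suc n)" "b \<in> D" "dist b v < 1 / real (Suc n)"
      using D(2) closure_approachable[of u D] closure_approachable[of v D]
      by (metis UNIV_I of_nat_0_less_iff zero_less_Suc zero_less_divide_1_iff)
    have "g p < g q" if "dist a p < 1 / real (Suc n)" "dist b q < 1 / real (Suc n)" for p q
    proof -
      have "dist p u < r" "dist q v < s"
        using dist_triangle3[of p u a] dist_triangle3[of q v b] ab that n by linarith+
      then show ?thesis
        using r(2)[of p] s(2)[of q] unfolding dist_real_def e_def by argo
    qed
    then have "\<exists>g\<in>G. sep a b n g"
      using g(1) unfolding sep_def by blast
    then have "sep a b n (choice (a, b, n))"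
      using choice by blast
    then have "choice (a, b, n) u < choice (a, b, n) v"
      using ab unfolding sep_def by blast
    then show ?thesis
      using ab unfolding I_def by blast
  qed
  moreover have "range (from_nat_into I) = I"
    by (rule range_from_nat_into[OF I(2,1)])
  ultimately have "\<forall>g\<in>G. \<forall>u v. g u < g v \<longrightarrow> (\<exists>n. choice (from_nat_into I n) u < choice (from_nat_into I n) v)"
    by (metis rangeE)
  moreover have "range (\<lambda>n. choice (from_nat_into I n)) \<subseteq> G"
    using choice by (metis image_subsetI prod_cases3)
  ultimately show ?thesis by blast
qed

text \<open>The terms after the first sum to at most \<open>1/2\<close> in absolute value, so a
  vanishing sum forces the first digit to be 0. Shifting the sequence gives the induction.\<close>

lemma ternary_series_eq_0:
  fixes h :: "nat \<Rightarrow> real"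
  assumes "\<And>n. h n \<in> {-1, 0, 1}" "(\<Sum>n. h n * (1/3) ^ n) = 0"
  shows "h n = 0"
  using assms
proof (induction n arbitrary: h)
  have sm: "summable (\<lambda>n. h n * (1/3) ^ n)" if "\<And>n. h n \<in> {-1, 0, 1}" for h :: "nat \<Rightarrow> real"
  proof (rule summable_comparison_test')
    show "norm (h n * (1/3) ^ n) \<le> (1/3) ^ n" for n
      using that[of n] by auto
  qed (simp add: summable_geometric)
  have tail: "h 0 = 0 \<and> (\<Sum>n. h (Suc n) * (1/3) ^ n) = 0"
    if h: "\<And>n. h n \<in> {-1, 0, 1}" "(\<Sum>n. h n * (1/3) ^ n) = 0" for h :: "nat \<Rightarrow> real"
  proof -
    define S where "S = (\<Sum>n. h (Suc n) * (1/3) ^ n)"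
    have sm1: "summable (\<lambda>n. h (Suc n) * (1/3) ^ n)"
      using h(1) by (intro sm)
    have "S / 3 = (\<Sum>n. h (Suc n) * (1/3) ^ Suc n)"
      unfolding S_def using suminf_divide[OF sm1, of 3] by simp
    also have "\<dots> = (\<Sum>n. h n * (1/3) ^ n) - h 0 * (1/3) ^ 0"
      by (rule suminf_split_head[OF sm[of h, OF h(1)]])
    finally have eq: "h 0 + S / 3 = 0"
      using h(2) by simp
    have "\<bar>S\<bar> \<le> (\<Sum>n. (1/3) ^ n)"
      unfolding S_def real_norm_def[symmetric]
    proof (rule norm_suminf_le)
      show "norm (h (Suc n) * (1/3) ^ n) \<le> (1/3) ^ n" for n
        using h(1)[of "Suc n"] by auto
    qed (simp add: summable_geometric)
    then have "\<bar>S\<bar> \<le> 3 / 2"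
      by (simp add: suminf_geometric)
    with eq h(1)[of 0] have "h 0 = 0"
      by auto
    with eq show ?thesis
      by (simp add: S_def)
  qed
  {
    case 0
    then show ?case using tail[of h] by simp
  next
    case (Suc n)
    show ?case
      using tail[of h, OF Suc.prems] Suc.prems(1) by (intro Suc.IH[of "\<lambda>n. h (Suc n)"]) auto
  }
qed

lemma int_complete_Lyapunov_function_exists:
  fixes \<Psi> :: "int \<Rightarrow> 'a::metric_space \<Rightarrow> 'a"
  assumes \<Psi>: "topological_semiflow \<Psi>" and X: "separable_space (euclidean :: 'a topology)"
  shows "\<exists>l. complete_Lyapunov_function \<Psi> l"
proof -
  define f where "f = \<Psi> 1"
  have "level_function f (\<lambda>_. 1)"
    by (simp add: level_function_def)
  then have ne: "{k. level_function f k} \<noteq> {}"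
    by blast
  have "continuous_on UNIV k" if "k \<in> {k. level_function f k}" for k
    using that by (simp add: level_function_def)
  from countable_subfamily_separating[OF X ne this]
  obtain g :: "nat \<Rightarrow> 'a \<Rightarrow> real" where range_g: "range g \<subseteq> {k. level_function f k}"
    and sep_g: "\<forall>k\<in>{k. level_function f k}. \<forall>u v. k u < k v \<longrightarrow> (\<exists>n. g n u < g n v)"
    by blast
  have g: "level_function f (g n)" for n
    using range_g by blast
  have sep: "\<exists>n. g n u < g n v" if "level_function f k" "k u < k v" for k u v
    using sep_g that by blast
  \<comment> \<open>The factor \<open>2/3\<close> normalises the geometric sum \<open>3/2\<close> to
    1.\<close>
  define l where "l x = (\<Sum>n. g n x * (1/3) ^ n) * (2/3)" for x
  have gb: "0 \<le> g n x" "g n x \<le> 1" for n x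
    using g by (auto simp: level_function_def)
  have nb: "norm (g n x * (1/3) ^ n) \<le> (1/3) ^ n" for n x
    using gb[of n x] by (simp add: mult_left_le_one_le)
  have sg: "summable (\<lambda>n. (1/3::real) ^ n)"
    by (simp add: summable_geometric)
  have sm: "summable (\<lambda>n. g n x * (1/3) ^ n)" for x
    using nb by (intro summable_comparison_test'[OF sg])
  have "continuous_on UNIV (\<lambda>x. \<Sum>n. g n x * (1/3) ^ n)"
  proof (rule uniform_limit_theorem)
    show "uniform_limit UNIV (\<lambda>n x. \<Sum>i<n. g i x * (1/3) ^ i) (\<lambda>x. \<Sum>n. g n x * (1/3) ^ n) sequentially"
      using nb sg by (rule Weierstrass_m_test)
    show "\<forall>\<^sub>F n in sequentially. continuous_on UNIV (\<lambda>x. \<Sum>i<n. g i x * (1/3) ^ i)"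
      using g by (intro always_eventually allI continuous_intros) (auto simp: level_function_def)
  qed simp
  then have cont: "continuous_on UNIV l"
    unfolding l_def by (intro continuous_intros)
  have range: "l x \<in> {0..1}" for x
  proof -
    have "(\<Sum>n. g n x * (1/3) ^ n) \<le> (\<Sum>n. (1/3) ^ n)"
      using nb[of _ x] by (intro suminf_le sm sg) (auto simp: abs_le_iff)
    moreover have "0 \<le> (\<Sum>n. g n x * (1/3) ^ n)"
      using gb by (intro suminf_nonneg sm) auto
    ultimately show ?thesis
      by (simp add: l_def suminf_geometric)
  qed
  have dec: "l (f x) \<le> l x" for x
    unfolding l_def
    by (intro mult_right_mono suminf_le sm level_function_decreasing[OF g]) auto
  \<comment> \<open>Some level function drops from 1 to 0 at \<open>x\<close>, so some
    \<open>g n\<close> drops strictly there, while no other term increases.\<close>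
  have dec_strict: "l (f x) < l x" if "\<not> reaches f x x" for x
  proof -
    obtain k where "level_function f k" "k (f x) = 0" "k x = 1"
      using level_function_exists[OF \<open>\<not> reaches f x x\<close>] by blast
    then obtain n where n: "g n (f x) < g n x"
      using sep[of k "f x" x] by auto
    have "0 < (\<Sum>n. g n x * (1/3) ^ n - g n (f x) * (1/3) ^ n)"
      using n by (intro suminf_pos2[of _ n] summable_diff sm)
        (auto intro!: mult_right_mono level_function_decreasing[OF g])
    then show ?thesis
      using suminf_diff[OF sm[of x] sm[of "f x"]] by (simp add: l_def)
  qed
  have dec_n: "l ((f ^^ n) x) \<le> l x" for n x
    by (induction n) (auto intro: order_trans dec)
  have dec_t: "l (\<Psi> t x) \<le> l x" if "t \<ge> 0" for t x
    using dec_n[of "nat t" x] that topological_semiflow_int_funpow[OF \<Psi>, of "nat t" x]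
    by (simp add: f_def)
  have fix_n: "l ((f ^^ n) x) = l x \<and> reaches f ((f ^^ n) x) ((f ^^ n) x)" if "reaches f x x" for n x
  proof (induction n)
    case (Suc n)
    let ?y = "(f ^^ n) x"
    have "l (f ?y) = l ?y"
      using level_function_recurrent(1)[OF g] Suc by (simp add: l_def)
    moreover have "reaches f (f ?y) (f ?y)"
      using reaches_image[OF topological_semiflow_continuous[OF \<Psi> zero_le_one], of f] Suc
      by (simp add: f_def)
    ultimately show ?case using Suc by simp
  qed (use that in simp)
  have eq_iff: "reaches f x y \<and> reaches f y x \<longleftrightarrow> l x = l y" if xy: "reaches f x x" "reaches f y y" for x y
  proof
    assume "reaches f x y \<and> reaches f y x"
    then have "g n x = g n y" for n
      using level_function_reaches_le[OF g xy(1,2)] level_function_reaches_le[OF g xy(2,1)]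
      by (simp add: antisym)
    then show "l x = l y"
      by (simp add: l_def)
  next
    assume "l x = l y"
    have "(\<Sum>n. (g n x - g n y) * (1/3) ^ n) = 0"
      using \<open>l x = l y\<close> by (simp add: l_def left_diff_distrib suminf_diff[OF sm sm, symmetric])
    moreover have "g n x - g n y \<in> {-1, 0, 1}" for n
      using level_function_recurrent(2)[OF g xy(1), of n] level_function_recurrent(2)[OF g xy(2), of n] by auto
    ultimately have eq: "g n x = g n y" for n
      using ternary_series_eq_0[of "\<lambda>n. g n x - g n y" n] by simp
    \<comment> \<open>A level function witnessing failure would satisfy
      \<open>k u = k (f u) = 0 < 1 = k v\<close>, so some \<open>g n\<close> would distinguish
      \<open>u\<close> from \<open>v\<close>.\<close>
    have "reaches f u v" if uv: "reaches f u u" "\<And>n. g n u = g n v" for u v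
    proof (rule ccontr)
      assume "\<not> reaches f u v"
      then obtain k where k: "level_function f k" "k (f u) = 0" "k v = 1"
        using level_function_exists by blast
      then show False
        using sep[of k u v] level_function_recurrent(1)[OF k(1) uv(1)] uv(2) by auto
    qed
    with eq xy show "reaches f x y \<and> reaches f y x" by metis
  qed
  have add: "\<Psi> (t + s) x = \<Psi> t (\<Psi> s x)" if "t \<ge> 0" "s \<ge> 0" for t s x
    using \<Psi> that by (simp add: topological_semiflow_def)
  have "complete_Lyapunov_function \<Psi> l"
    unfolding complete_Lyapunov_function_def int_ChRec_iff[OF \<Psi>] int_chain_equivalent_iff[OF \<Psi>]
      f_def[symmetric]
  proof (intro conjI allI ballI impI)
    fix x and t1 t2 :: int assume "0 \<le> t1" "0 \<le> t2" "t1 < t2"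
    then show "l (\<Psi> t2 x) \<le> l (\<Psi> t1 x)"
      using dec_t[of "t2 - t1" "\<Psi> t1 x"] add[of "t2 - t1" t1 x] by simp
  next
    fix x and t :: int assume "\<not> reaches f x x" "0 < t"
    then show "l (\<Psi> t x) < l x"
      using dec_t[of "t - 1" "f x"] add[of "t - 1" 1 x] dec_strict[of x] by (simp add: f_def)
  next
    fix x and t :: int assume "x \<in> ChRec \<Psi>" "0 \<le> t"
    then show "l (\<Psi> t x) = l x"
      using fix_n[of x "nat t"] topological_semiflow_int_funpow[OF \<Psi>, of "nat t" x]
      by (simp add: f_def int_ChRec_iff[OF \<Psi>])
  next
    fix x y assume "x \<in> ChRec \<Psi>" "y \<in> ChRec \<Psi>"
    then show "reaches f x y \<and> reaches f y x \<longleftrightarrow> l x = l y"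
      by (intro eq_iff) (auto simp: f_def int_ChRec_iff[OF \<Psi>])
  qed (rule cont range)+
  then show ?thesis by blast
qed

section \<open>Averaging a discrete-time Lyapunov function over one time unit\<close>

lemma complete_Lyapunov_function_integral:
  fixes \<Phi> :: "real \<Rightarrow> 'a::metric_space \<Rightarrow> 'a" and \<Psi> :: "int \<Rightarrow> 'a \<Rightarrow> 'a"
  assumes \<Phi>: "topological_semiflow \<Phi>" and \<Psi>: "topological_semiflow \<Psi>" "\<And>x. \<Psi> 1 x = \<Phi> 1 x"
    and l: "complete_Lyapunov_function \<Psi> l"
  shows "complete_Lyapunov_function \<Phi> (\<lambda>x. integral {0..1} (\<lambda>s. l (\<Phi> s x)))"
proof -
  have one: "\<Psi> 1 = \<Phi> 1"
    using \<Psi>(2) by blast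
  \<comment> \<open>A semiflow \<open>\<Psi>\<close> may differ from the integer restriction of
    \<open>\<Phi>\<close> at negative times, so the two are compared through their common time-one
    map.\<close>
  have rec: "ChRec \<Psi> = ChRec \<Phi>"
    using int_ChRec_iff[OF \<Psi>(1)] int_ChRec_iff[OF topological_semiflow_time_one[OF \<Phi>]]
    by (auto simp: one ChRec_time_one[OF \<Phi>])
  have equiv: "chain_equivalent \<Psi> x y \<longleftrightarrow> chain_equivalent \<Phi> x y" for x y
    using int_chain_equivalent_iff[OF \<Psi>(1), of x y]
      int_chain_equivalent_iff[OF topological_semiflow_time_one[OF \<Phi>], of x y]
    by (simp add: one chain_equivalent_time_one[OF \<Phi>])
  have lc: "continuous_on UNIV l" and l01: "\<And>x. 0 \<le> l x \<and> l x \<le> 1"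
    using l by (auto simp: complete_Lyapunov_function_def)
  have \<Psi>0: "\<Psi> 0 x = x" for x
    using \<Psi>(1) by (simp add: topological_semiflow_def)
  have l_strict: "l (\<Phi> 1 x) < l x" if "x \<notin> ChRec \<Phi>" for x
    using l that unfolding complete_Lyapunov_function_def rec one[symmetric] by (metis zero_less_one)
  have l_dec: "l (\<Phi> 1 x) \<le> l x" for x
    using l unfolding complete_Lyapunov_function_def one[symmetric] by (metis \<Psi>0 order_refl zero_le_one zero_less_one)
  have l_equiv: "chain_equivalent \<Phi> x y \<longleftrightarrow> l x = l y" if "x \<in> ChRec \<Phi>" "y \<in> ChRec \<Phi>" for x y
    using l that unfolding complete_Lyapunov_function_def rec equiv by blast
  define L where "L x = integral {0..1} (\<lambda>s. l (\<Phi> s x))" for x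
  have orbit: "\<Phi> s x \<in> ChRec \<Phi> \<and> l (\<Phi> s x) = l x" if x: "x \<in> ChRec \<Phi>" and "s \<ge> 0" for x s
  proof -
    have "\<Phi> 0 x = x"
      using \<Phi> by (simp add: topological_semiflow_def)
    then have "reaches (\<Phi> 1) (\<Phi> s x) x" "reaches (\<Phi> 1) x (\<Phi> s x)"
      using reaches_along_orbit[OF \<Phi> recurrent_reaches_self[OF \<Phi> x], of s 0] \<open>s \<ge> 0\<close>
        reaches_along_orbit[OF \<Phi> recurrent_reaches_self[OF \<Phi> x], of 0 s] by auto
    then have "chain_equivalent \<Phi> (\<Phi> s x) x"
      using int_chain_equivalent_iff[OF \<Psi>(1)] by (simp add: one flip: equiv)
    then show ?thesis
      using chain_equivalent_imp_ChRec l_equiv by blast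
  qed
  have L_rec: "L x = l x" if "x \<in> ChRec \<Phi>" for x
  proof -
    have "L x = integral {0..1} (\<lambda>s::real. l x)"
      unfolding L_def by (rule integral_cong) (use orbit[OF that] in auto)
    then show ?thesis by simp
  qed
  have lc_time: "continuous_on {0..} (\<lambda>s. l (\<Phi> s x))" for x
    by (rule continuous_on_compose2[OF lc semiflow_continuous_time[OF \<Phi>]]) auto
  have lc_shift: "continuous_on {0..} (\<lambda>s. l (\<Phi> (1 + s) x))" for x
    by (rule continuous_on_compose2[OF lc_time]) (auto intro!: continuous_intros)
  have "continuous_on UNIV (\<lambda>x. integral (cbox 0 1) (\<lambda>s. l (\<Phi> s x)))"
  proof (rule integral_continuous_on_param)
    have "continuous_on ({0..} \<times> UNIV) (\<lambda>(t, x). \<Phi> t x)"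
      using \<Phi> by (simp add: topological_semiflow_def)
    then have "continuous_on (UNIV \<times> cbox 0 1) (\<lambda>z :: 'a \<times> real. \<Phi> (snd z) (fst z))"
      using continuous_on_compose2[of "{0..} \<times> UNIV" "\<lambda>(t, x). \<Phi> t x" "UNIV \<times> cbox 0 1" "\<lambda>z. (snd z, fst z)"]
      by (fastforce intro: continuous_intros)
    then show "continuous_on (UNIV \<times> cbox 0 1) (\<lambda>(x, s). l (\<Phi> s x))"
      unfolding case_prod_unfold by (rule continuous_on_compose2[OF lc]) auto
  qed
  then have L_cont: "continuous_on UNIV L"
    by (simp add: L_def[abs_def])
  have L_range: "L x \<in> {0..1}" for x
  proof -
    have int: "(\<lambda>s. l (\<Phi> s x)) integrable_on {0..1}"
      by (intro integrable_continuous_real continuous_on_subset[OF lc_time]) auto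
    have "L x \<le> integral {0..1} (\<lambda>s::real. 1::real)"
      unfolding L_def using l01 by (intro integral_le int) auto
    moreover have "0 \<le> L x"
      unfolding L_def using l01 by (intro integral_nonneg int) auto
    ultimately show ?thesis by simp
  qed
  have diff: "L x - L (\<Phi> t x) = integral {0..t} (\<lambda>s. l (\<Phi> s x) - l (\<Phi> (1 + s) x))" if "t \<ge> 0" for t x
  proof -
    define h where "h s = l (\<Phi> s x)" for s
    have hc: "continuous_on {0..} h" "continuous_on {0..} (\<lambda>s. h (1 + s))"
      using lc_time[of x] lc_shift[of x] by (simp_all add: h_def)
    have int: "h integrable_on {a..b}" if "a \<ge> 0" for a b
      using that by (intro integrable_continuous_real continuous_on_subset[OF hc(1)]) auto
    have "L (\<Phi> t x) = integral {0..1} (h \<circ> (+) t)"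
      unfolding L_def h_def using \<open>t \<ge> 0\<close>
      by (intro integral_cong) (simp add: semiflow_add[OF \<Phi>] add.commute)
    also have "\<dots> = integral {t..1 + t} h"
      by (simp add: integral_shift_Icc_real)
    finally have "L (\<Phi> t x) = integral {t..1 + t} h" .
    \<comment> \<open>Both sides are the integral over \<open>{0..1 + t}\<close>, so no case
      distinction on whether \<open>t\<close> exceeds 1 arises.\<close>
    moreover have "integral {0..t} h + integral {t..1 + t} h = integral {0..1} h + integral {1..1 + t} h"
      using \<open>t \<ge> 0\<close> Henstock_Kurzweil_Integration.integral_combine[OF _ _ int, of 0 t "1 + t"]
        Henstock_Kurzweil_Integration.integral_combine[OF _ _ int, of 0 1 "1 + t"] by simp
    moreover have "integral {1..1 + t} h = integral {0..t} (\<lambda>s. h (1 + s))"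
      using integral_shift_Icc_real[of 0 t h 1] by (simp add: o_def add.commute)
    moreover have "integral {0..t} (\<lambda>s. h s - h (1 + s)) = integral {0..t} h - integral {0..t} (\<lambda>s. h (1 + s))"
      by (intro integral_diff int integrable_continuous_real continuous_on_subset[OF hc(2)]) auto
    moreover have "L x = integral {0..1} h"
      unfolding L_def h_def ..
    ultimately have "L x - L (\<Phi> t x) = integral {0..t} (\<lambda>s. h s - h (1 + s))"
      by linarith
    then show ?thesis
      by (simp add: h_def)
  qed
  have diff_cont: "continuous_on {0..t} (\<lambda>s. l (\<Phi> s x) - l (\<Phi> (1 + s) x))" for t x
    by (intro continuous_intros continuous_on_subset[OF lc_time] continuous_on_subset[OF lc_shift]) auto
  have diff_nonneg: "0 \<le> l (\<Phi> s x) - l (\<Phi> (1 + s) x)" if "s \<ge> 0" for s x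
    using l_dec[of "\<Phi> s x"] that by (simp add: semiflow_add[OF \<Phi>])
  have L_dec: "L (\<Phi> t x) \<le> L x" if "t \<ge> 0" for t x
  proof -
    have "0 \<le> L x - L (\<Phi> t x)"
      unfolding diff[OF that]
      by (intro integral_nonneg integrable_continuous_real diff_cont diff_nonneg) auto
    then show ?thesis by simp
  qed
  have L_strict: "L (\<Phi> t x) < L x" if "t > 0" "x \<notin> ChRec \<Phi>" for t x
  proof (rule ccontr)
    assume "\<not> L (\<Phi> t x) < L x"
    then have "L x - L (\<Phi> t x) = 0"
      using L_dec[of t x] that by simp
    then have "integral {0..t} (\<lambda>s. l (\<Phi> s x) - l (\<Phi> (1 + s) x)) = 0"
      using diff[of t x] that by simp
    moreover have "0 \<le> l (\<Phi> s x) - l (\<Phi> (1 + s) x)" if "s \<in> {0..t}" for s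
      using that by (intro diff_nonneg) simp
    \<comment> \<open>A continuous nonnegative integrand with integral 0 vanishes identically; at
      \<open>s = 0\<close> this contradicts the strict decrease of \<open>l\<close> under the
      time-one map.\<close>
    ultimately have "\<forall>s\<in>{0..t}. l (\<Phi> s x) - l (\<Phi> (1 + s) x) = 0"
      by (intro iffD1[OF integral_eq_0_iff[OF diff_cont \<open>t > 0\<close>]])
    then have "l (\<Phi> 0 x) - l (\<Phi> (1 + 0) x) = 0"
      using that(1) by (metis atLeastAtMost_iff less_imp_le order_refl)
    then show False
      using l_strict[OF that(2)] \<Phi> by (simp add: topological_semiflow_def)
  qed
  have "complete_Lyapunov_function \<Phi> L"
    unfolding complete_Lyapunov_function_def
  proof (intro conjI allI ballI impI)
    fix x and t1 t2 :: real assume "0 \<le> t1" "0 \<le> t2" "t1 < t2"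
    then show "L (\<Phi> t2 x) \<le> L (\<Phi> t1 x)"
      using L_dec[of "t2 - t1" "\<Phi> t1 x"] by (simp add: semiflow_add[OF \<Phi>])
  next
    fix x and t :: real assume "x \<in> ChRec \<Phi>" "0 \<le> t"
    then show "L (\<Phi> t x) = L x"
      using orbit[of x t] by (simp add: L_rec)
  qed (simp_all add: L_cont L_range L_strict L_rec l_equiv del: atLeastAtMost_iff)
  then show ?thesis
    by (simp add: L_def[abs_def])
qed

theorem theorem5p15:
  fixes \<Phi> :: "real \<Rightarrow> 'a::metric_space \<Rightarrow> 'a"
  assumes "topological_flow \<Phi> \<or> topological_semiflow \<Phi>"
  shows "(\<forall>(\<Psi> :: int \<Rightarrow> 'a \<Rightarrow> 'a) (l :: 'a \<Rightarrow> real).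
            (topological_flow \<Phi> \<and> topological_flow \<Psi> \<or>
             topological_semiflow \<Phi> \<and> topological_semiflow \<Psi>) \<and>
            (\<forall>x. \<Psi> 1 x = \<Phi> 1 x) \<and>
            complete_Lyapunov_function \<Psi> l \<longrightarrow>
            complete_Lyapunov_function \<Phi> (\<lambda>x. integral {0..1} (\<lambda>s. l (\<Phi> s x)))) \<and>
         (separable_space (euclidean :: 'a topology) \<longrightarrow>
            (\<exists>L. complete_Lyapunov_function \<Phi> L))"
proof -
  \<comment> \<open>Flows are semiflows, so both cases of the theorem are treated at once.\<close>
  have \<Phi>: "topological_semiflow \<Phi>"
    using assms topological_flow_imp_semiflow by blast
  moreover have "\<exists>L. complete_Lyapunov_function \<Phi> L" if X: "separable_space (euclidean :: 'a topology)"
  proof -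
    have \<Psi>: "topological_semiflow (\<lambda>n::int. \<Phi> (of_int n))"
      by (rule topological_semiflow_time_one[OF \<Phi>])
    obtain l where "complete_Lyapunov_function (\<lambda>n::int. \<Phi> (of_int n)) l"
      using int_complete_Lyapunov_function_exists[OF \<Psi> X] by blast
    then have "complete_Lyapunov_function \<Phi> (\<lambda>x. integral {0..1} (\<lambda>s. l (\<Phi> s x)))"
      by (intro complete_Lyapunov_function_integral[OF \<Phi> \<Psi>]) auto
    then show ?thesis by blast
  qed
  moreover have "complete_Lyapunov_function \<Phi> (\<lambda>x. integral {0..1} (\<lambda>s. l (\<Phi> s x)))"
    if "topological_semiflow \<Psi>" "\<forall>x. \<Psi> 1 x = \<Phi> 1 x" "complete_Lyapunov_function \<Psi> l"
    for \<Psi> :: "int \<Rightarrow> 'a \<Rightarrow> 'a" and l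
    using that by (intro complete_Lyapunov_function_integral[OF \<Phi>]) auto
  ultimately show ?thesis
    by (auto dest: topological_flow_imp_semiflow)
qed

end
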